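(* Let $p>N+2\gamma$. Then for all $u\in C_{0}^{\infty}(\mathbb{R}^{N}\setminus\{0\})$, $$\int_{\mathbb{R}^{N}}|\nabla_{k}u|^{p}\,d\mu_{k}\ \geq\ \left(\frac{p-N-2\gamma}{p}\right)^{p}\int_{\mathbb{R}^{N}}\frac{|u|^{p}}{|x|^{p}}\,d\mu_{k},$$ and the constant $\left(\frac{p-N-2\gamma}{p}\right)^{p}$ is sharp, i.e. it cannot be replaced by any larger constant for which the inequality holds for all $u\in C_{0}^{\infty}(\mathbb{R}^{N}\setminus\{0\})$.
   Context: Dunkl setting. $R\subset\mathbb{R}^{N}\setminus\{0\}$ is a root system: a finite set with $R\cap\mathbb{R}\alpha=\{-\alpha,\alpha\}$ and $\sigma_{\alpha}(R)=R$ for all $\alpha\in R$, where $\sigma_{\alpha}x=x-2\frac{\langle\alpha,x\rangle}{\langle\alpha,\alpha\rangle}\alpha$; it is normalized so that $|\alpha|^{2}=2$ for all $\alpha\in R$. $G$ is the finite group generated by the reflections $\sigma_{\alpha}$, $\alpha\in R$. $R_{+}$ is a fixed positive subsystem, so $R=R_{+}\cup(-R_{+})$ (disjoint union). $k:R\to[0,\infty)$, $\alpha\mapsto k_{\alpha}$, is a $G$-invariant function, and $\gamma:=\sum_{\alpha\in R_{+}}k_{\alpha}$. The Dunkl operators are $$T_{i}u(x)=\partial_{i}u(x)+\sum_{\alpha\in R_{+}}k_{\alpha}\alpha_{i}\frac{u(x)-u(\sigma_{\alpha}x)}{\langle\alpha,x\rangle},\qquad i=1,\dots,N,$$ and $\nabla_{k}=(T_{1},\dots,T_{N})$.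 The weighted measure is $d\mu_{k}=\omega_{k}(x)\,dx$ with $\omega_{k}(x)=\prod_{\alpha\in R_{+}}|\langle\alpha,x\rangle|^{2k_{\alpha}}$. Functions $u$ are real-valued. *)

theory Defs
  imports "HOL-Analysis.Analysis"
begin

definition reflection :: "real ^ 'n \<Rightarrow> real ^ 'n \<Rightarrow> real ^ 'n" where
  "reflection \<alpha> x = x - (2 * (\<alpha> \<bullet> x) / (\<alpha> \<bullet> \<alpha>)) *\<^sub>R \<alpha>"

definition root_system :: "(real ^ 'n) set \<Rightarrow> bool" where
  "root_system R \<longleftrightarrow>
     finite R \<and> 0 \<notin> R \<and>
     (\<forall>\<alpha>\<in>R. R \<inter> {c *\<^sub>R \<alpha> |c. True} = {- \<alpha>, \<alpha>}) \<and>
     (\<forall>\<alpha>\<in>R. reflection \<alpha> ` R = R)"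

definition normalized_root_system :: "(real ^ 'n) set \<Rightarrow> bool" where
  "normalized_root_system R \<longleftrightarrow> root_system R \<and> (\<forall>\<alpha>\<in>R. (norm \<alpha>)\<^sup>2 = 2)"

text \<open>Separation of the two halves by a hyperplane is not required, so every choice of one root
  from each pair of opposite roots is allowed, in particular every positive subsystem in the
  stricter sense.  The Dunkl operators, the weight and the sum of the multiplicities do not depend
  on the choice.\<close>

definition positive_subsystem :: "(real ^ 'n) set \<Rightarrow> (real ^ 'n) set \<Rightarrow> bool" where
  "positive_subsystem R Rp \<longleftrightarrow> R = Rp \<union> uminus ` Rp \<and> Rp \<inter> uminus ` Rp = {}"

text \<open>The group generated by the reflections; closure under inverses is automatic because
  reflections are involutions.\<close>

inductive_set reflection_group :: "(real ^ 'n) set \<Rightarrow> (real ^ 'n \<Rightarrow> real ^ 'n) set"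
  for R :: "(real ^ 'n) set" where
  one: "id \<in> reflection_group R"
| step: "\<alpha> \<in> R \<Longrightarrow> g \<in> reflection_group R \<Longrightarrow> reflection \<alpha> \<circ> g \<in> reflection_group R"

text \<open>Only the values of \<open>k\<close> on \<open>R\<close> matter.\<close>

definition multiplicity_function :: "(real ^ 'n) set \<Rightarrow> (real ^ 'n \<Rightarrow> real) \<Rightarrow> bool" where
  "multiplicity_function R k \<longleftrightarrow>
     (\<forall>\<alpha>\<in>R. 0 \<le> k \<alpha>) \<and> (\<forall>g\<in>reflection_group R. \<forall>\<alpha>\<in>R. k (g \<alpha>) = k \<alpha>)"

definition dunkl_gamma :: "(real ^ 'n) set \<Rightarrow> (real ^ 'n \<Rightarrow> real) \<Rightarrow> real" where
  "dunkl_gamma Rp k = (\<Sum>\<alpha>\<in>Rp. k \<alpha>)"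

definition partial_derivative :: "'n \<Rightarrow> (real ^ 'n \<Rightarrow> real) \<Rightarrow> real ^ 'n \<Rightarrow> real" where
  "partial_derivative i u x = frechet_derivative u (at x) (axis i 1)"

primrec times_continuously_differentiable :: "nat \<Rightarrow> (real ^ 'n \<Rightarrow> real) \<Rightarrow> bool" where
  "times_continuously_differentiable 0 u \<longleftrightarrow> continuous_on UNIV u"
| "times_continuously_differentiable (Suc m) u \<longleftrightarrow>
     (\<forall>x. u differentiable (at x)) \<and>
     (\<forall>i. times_continuously_differentiable m (partial_derivative i u))"

definition smooth :: "(real ^ 'n \<Rightarrow> real) \<Rightarrow> bool" where
  "smooth u \<longleftrightarrow> (\<forall>m. times_continuously_differentiable m u)"

text \<open>Smooth functions with compact support in the complement of the origin, regarded as functions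
  on the whole space via extension by zero.\<close>

definition test_functions_off_origin :: "(real ^ 'n \<Rightarrow> real) set" where
  "test_functions_off_origin =
     {u. smooth u \<and> compact (closure {x. u x \<noteq> 0}) \<and> 0 \<notin> closure {x. u x \<noteq> 0}}"

text \<open>On a hyperplane orthogonal to a root the difference quotient reads \<open>0 / 0 = 0\<close> instead of its
  continuous extension.  These finitely many hyperplanes are Lebesgue null sets, so integrals are
  not affected.\<close>

definition dunkl_operator ::
    "(real ^ 'n) set \<Rightarrow> (real ^ 'n \<Rightarrow> real) \<Rightarrow> 'n \<Rightarrow> (real ^ 'n \<Rightarrow> real) \<Rightarrow> real ^ 'n \<Rightarrow> real" where
  "dunkl_operator Rp k i u x =
     partial_derivative i u x
     + (\<Sum>\<alpha>\<in>Rp. k \<alpha> * \<alpha> $ i * ((u x - u (reflection \<alpha> x)) / (\<alpha> \<bullet> x)))"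

definition dunkl_gradient ::
    "(real ^ 'n) set \<Rightarrow> (real ^ 'n \<Rightarrow> real) \<Rightarrow> (real ^ 'n \<Rightarrow> real) \<Rightarrow> real ^ 'n \<Rightarrow> real ^ 'n" where
  "dunkl_gradient Rp k u x = (\<chi> i. dunkl_operator Rp k i u x)"

text \<open>Since \<open>0 powr 0 = 0\<close>, the weight vanishes on the hyperplanes orthogonal to roots even where
  \<open>k\<close> is zero; again this concerns a null set only.\<close>

definition dunkl_weight :: "(real ^ 'n) set \<Rightarrow> (real ^ 'n \<Rightarrow> real) \<Rightarrow> real ^ 'n \<Rightarrow> real" where
  "dunkl_weight Rp k x = (\<Prod>\<alpha>\<in>Rp. \<bar>\<alpha> \<bullet> x\<bar> powr (2 * k \<alpha>))"

definition dunkl_measure :: "(real ^ 'n) set \<Rightarrow> (real ^ 'n \<Rightarrow> real) \<Rightarrow> (real ^ 'n) measure" where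
  "dunkl_measure Rp k = density lborel (\<lambda>x. ennreal (dunkl_weight Rp k x))"

text \<open>For test functions both integrands below are bounded, Borel measurable and of compact support,
  hence integrable for \<open>p > 0\<close>; the Bochner integral's default value \<open>0\<close> plays no role.\<close>

definition dunkl_hardy_inequality ::
    "(real ^ 'n) set \<Rightarrow> (real ^ 'n \<Rightarrow> real) \<Rightarrow> real \<Rightarrow> real \<Rightarrow> (real ^ 'n \<Rightarrow> real) \<Rightarrow> bool" where
  "dunkl_hardy_inequality Rp k p C u \<longleftrightarrow>
     (LINT x|dunkl_measure Rp k. norm (dunkl_gradient Rp k u x) powr p)
       \<ge> C * (LINT x|dunkl_measure Rp k. \<bar>u x\<bar> powr p / norm x powr p)"

end

theory Submission
  imports Defs "HOL-Real_Asymp.Real_Asymp"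
begin

text \<open>
  Write \<open>Q = N + 2 \<gamma>\<close> for the degree by which the weighted measure \<open>\<mu>\<close> scales under dilations,
  \<open>c = (p - Q) / p\<close>, and \<open>v = u / |x|\<close>.

  \<^bold>\<open>The inequality.\<close>  Differentiating \<open>\<integral> |v (s x)|\<^sup>p d\<mu> = s powr (-Q) \<integral> |v|\<^sup>p d\<mu>\<close> at \<open>s = 1\<close> gives an
  integrated form of Euler's identity (\<open>euler_identity\<close>), which replaces integration by parts; for
  \<open>v = u / |x|\<close> it reads \<open>c \<integral> |v|\<^sup>p d\<mu> = \<integral> \<phi>(v) (x \<bullet> \<nabla>u) / |x| d\<mu>\<close> with the odd power
  \<open>\<phi>(t) = sgn t |t| powr (p - 1)\<close> (\<open>radial_derivative_integral\<close>).
  In the direction \<open>x\<close> the denominators of the Dunkl operators cancel, so that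
  \<open>x \<bullet> \<nabla>u = x \<bullet> \<nabla>\<^sub>k u - \<Sum> k\<^sub>\<alpha> (u(x) - u(\<sigma>\<^sub>\<alpha> x))\<close>.  Because \<open>\<mu>\<close> and \<open>|x|\<close> are invariant under \<open>\<sigma>\<^sub>\<alpha>\<close> and
  \<open>\<phi>\<close> is increasing, the integral of \<open>\<phi>(v(x)) (v(x) - v(\<sigma>\<^sub>\<alpha> x))\<close> equals half the integral of
  \<open>(\<phi>(v(x)) - \<phi>(v(\<sigma>\<^sub>\<alpha> x))) (v(x) - v(\<sigma>\<^sub>\<alpha> x)) \<ge> 0\<close> (\<open>reflection_term_nonneg\<close>).  The difference terms
  can therefore be dropped, which leaves \<open>c \<integral> |v|\<^sup>p d\<mu> \<le> \<integral> |v| powr (p - 1) |\<nabla>\<^sub>k u| d\<mu>\<close>.  Young's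
  inequality, applied pointwise to \<open>c |v|\<close> and \<open>|\<nabla>\<^sub>k u|\<close>, turns this into the claim.

  \<^bold>\<open>Optimality.\<close>  On radial functions the Dunkl gradient is the ordinary gradient.  The function
  \<open>|x| powr c\<close> satisfies \<open>|\<nabla>u| = c |u| / |x|\<close>, and \<open>|u|\<^sup>p / |x|\<^sup>p = |x| powr (-Q)\<close> has the same integral over
  every dyadic shell, so that its integral over \<open>2 \<le> |x| \<le> 2\<^sup>m\<close> grows linearly in \<open>m\<close>.
  The test functions are smooth cutoffs of \<open>(1 + |x|\<^sup>2) powr (c / 2)\<close>, which is smooth at the origin and still
  satisfies \<open>|\<nabla>u| \<le> c |u| / |x|\<close>.  The cutoff near \<open>|x| = 1\<close> is fixed, and by scaling the cutoff near
  \<open>|x| = 2\<^sup>m\<close> contributes an amount to \<open>\<integral> |\<nabla>u|\<^sup>p d\<mu>\<close> that is bounded independently of \<open>m\<close>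
  (\<open>extremal_gradient_bound\<close>).  A constant \<open>C > c\<^sup>p\<close> would thus make
  a quantity that grows linearly in \<open>m\<close> bounded.
\<close>

section \<open>Reflections and Lebesgue measure\<close>

lemma borel_measurable_linear:
  fixes T :: "'a::euclidean_space \<Rightarrow> 'b::euclidean_space"
  assumes "linear T"
  shows "T \<in> borel_measurable borel"
  using assms by (intro borel_measurable_continuous_onI linear_continuous_on linear_conv_bounded_linear[THEN iffD1])

lemma nn_integral_lborel_translate:
  fixes f :: "'a::euclidean_space \<Rightarrow> ennreal"
  assumes [measurable]: "f \<in> borel_measurable borel"
  shows "(\<integral>\<^sup>+x. f (z + x) \<partial>lborel) = (\<integral>\<^sup>+x. f x \<partial>lborel)"
proof -
  have "(\<integral>\<^sup>+x. f x \<partial>lborel) = (\<integral>\<^sup>+x. f x \<partial>distr lborel borel ((+) z))"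
    by (simp add: lborel_distr_plus)
  also have "\<dots> = (\<integral>\<^sup>+x. f (z + x) \<partial>lborel)"
    by (subst nn_integral_distr) auto
  finally show ?thesis by simp
qed

text \<open>The argument is the one for uniqueness of Haar measure.  Multiply the left-hand side by the volume of the unit
ball, written as an integral of its indicator function \<open>g\<close>, and shift \<open>x\<close> by \<open>T\<^sup>-\<^sup>1 y\<close> and then \<open>y\<close> by
\<open>- T x\<close>: the map \<open>T\<close> now only occurs in the factor \<open>g (y - T x)\<close>.  One more shift of \<open>x\<close> turns this
into \<open>g (- T x) = g x\<close>.\<close>

lemma nn_integral_lborel_orthogonal_transformation:
  fixes f :: "'a::euclidean_space \<Rightarrow> ennreal" and T :: "'a \<Rightarrow> 'a"
  assumes T: "orthogonal_transformation T"
    and f [measurable]: "f \<in> borel_measurable borel"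
  shows "(\<integral>\<^sup>+x. f (T x) \<partial>lborel) = (\<integral>\<^sup>+x. f x \<partial>lborel)"
proof -
  define g :: "'a \<Rightarrow> ennreal" where "g = indicator (ball 0 1)"
  define V where "V = (\<integral>\<^sup>+y. g y \<partial>lborel)"
  have lin: "linear T"
    using T by (rule orthogonal_transformation_linear)
  have [measurable]: "T \<in> borel_measurable borel"
    using lin by (rule borel_measurable_linear)
  have [measurable]: "g \<in> borel_measurable borel"
    unfolding g_def by (intro borel_measurable_indicator borel_open open_ball)
  have gT: "g (- T x) = g x" for x
    using T by (simp add: g_def indicator_def orthogonal_transformation_norm)
  have "(\<integral>\<^sup>+x. f (T x) \<partial>lborel) * V = (\<integral>\<^sup>+y. (\<integral>\<^sup>+x. f (T x) * g y \<partial>lborel) \<partial>lborel)"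
    by (simp add: V_def nn_integral_cmult nn_integral_multc)
  also have "\<dots> = (\<integral>\<^sup>+y. (\<integral>\<^sup>+x. f (y + T x) * g y \<partial>lborel) \<partial>lborel)"
  proof (rule nn_integral_cong)
    fix y :: 'a
    obtain z where z: "T z = y"
      using orthogonal_transformation_surj[OF T] by (metis surjD)
    have "(\<integral>\<^sup>+x. f (T x) * g y \<partial>lborel) = (\<integral>\<^sup>+x. f (T (z + x)) * g y \<partial>lborel)"
      by (rule nn_integral_lborel_translate[symmetric]) measurable
    then show "(\<integral>\<^sup>+x. f (T x) * g y \<partial>lborel) = (\<integral>\<^sup>+x. f (y + T x) * g y \<partial>lborel)"
      by (simp add: linear_add[OF lin] z)
  qed
  also have "\<dots> = (\<integral>\<^sup>+x. (\<integral>\<^sup>+y. f (y + T x) * g y \<partial>lborel) \<partial>lborel)"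
    by (rule lborel_pair.Fubini') measurable
  also have "\<dots> = (\<integral>\<^sup>+x. (\<integral>\<^sup>+y. f y * g (y - T x) \<partial>lborel) \<partial>lborel)"
  proof (rule nn_integral_cong)
    fix x :: 'a
    have "(\<integral>\<^sup>+y. f (T x + y) * g (T x + y - T x) \<partial>lborel) = (\<integral>\<^sup>+y. f y * g (y - T x) \<partial>lborel)"
      by (rule nn_integral_lborel_translate) measurable
    then show "(\<integral>\<^sup>+y. f (y + T x) * g y \<partial>lborel) = (\<integral>\<^sup>+y. f y * g (y - T x) \<partial>lborel)"
      by (simp add: add.commute)
  qed
  also have "\<dots> = (\<integral>\<^sup>+y. (\<integral>\<^sup>+x. f y * g (y - T x) \<partial>lborel) \<partial>lborel)"
    by (rule lborel_pair.Fubini') measurable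
  also have "\<dots> = (\<integral>\<^sup>+y. f y * V \<partial>lborel)"
  proof (rule nn_integral_cong)
    fix y :: 'a
    obtain z where z: "T z = y"
      using orthogonal_transformation_surj[OF T] by (metis surjD)
    have "(\<integral>\<^sup>+x. g (y - T x) \<partial>lborel) = (\<integral>\<^sup>+x. g (y - T (z + x)) \<partial>lborel)"
      by (rule nn_integral_lborel_translate[symmetric]) measurable
    also have "\<dots> = V"
      by (simp add: linear_add[OF lin] z gT V_def)
    finally show "(\<integral>\<^sup>+x. f y * g (y - T x) \<partial>lborel) = f y * V"
      by (simp add: nn_integral_cmult)
  qed
  also have "\<dots> = (\<integral>\<^sup>+x. f x \<partial>lborel) * V"
    by (simp add: nn_integral_multc)
  finally have eq: "(\<integral>\<^sup>+x. f (T x) \<partial>lborel) * V = (\<integral>\<^sup>+x. f x \<partial>lborel) * V" .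
  have "V = emeasure lborel (ball (0::'a) 1)"
    by (simp add: V_def g_def)
  also have "\<dots> = ennreal (measure lborel (ball (0::'a) 1))"
    using emeasure_lborel_ball_finite[of "0::'a" 1] by (intro emeasure_eq_ennreal_measure) auto
  finally have "V = ennreal (measure lborel (ball (0::'a) 1))" .
  then have "V \<noteq> 0" "V \<noteq> top"
    using content_ball_pos[of 1 "0::'a"] by auto
  with eq show ?thesis
    by (metis ennreal_mult_divide_eq)
qed

lemma distr_lborel_orthogonal_transformation:
  fixes T :: "'a::euclidean_space \<Rightarrow> 'a"
  assumes T: "orthogonal_transformation T"
  shows "distr lborel borel T = lborel"
proof (rule measure_eqI)
  fix A :: "'a set" assume "A \<in> sets (distr lborel borel T)"
  then have [measurable]: "A \<in> sets borel" by simp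
  have [measurable]: "T \<in> borel_measurable borel"
    using orthogonal_transformation_linear[OF T] by (rule borel_measurable_linear)
  have "emeasure (distr lborel borel T) A = (\<integral>\<^sup>+x. indicator A x \<partial>distr lborel borel T)"
    by simp
  also have "\<dots> = (\<integral>\<^sup>+x. indicator A (T x) \<partial>lborel)"
    by (rule nn_integral_distr) auto
  also have "\<dots> = emeasure lborel A"
    by (subst nn_integral_lborel_orthogonal_transformation[OF T]) auto
  finally show "emeasure (distr lborel borel T) A = emeasure lborel A" .
qed simp

lemma reflection_inner:
  assumes "\<alpha> \<noteq> 0"
  shows "reflection \<alpha> x \<bullet> reflection \<alpha> y = x \<bullet> y"
proof -
  have "\<alpha> \<bullet> \<alpha> \<noteq> 0" using assms by simp
  then show ?thesis
    by (simp add: reflection_def inner_simps inner_commute field_simps)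
qed

lemma linear_reflection: "linear (reflection \<alpha>)"
  by (rule linearI) (simp_all add: reflection_def inner_simps algebra_simps add_divide_distrib)

lemma measurable_reflection [measurable]: "reflection \<alpha> \<in> borel_measurable borel"
  using linear_reflection by (rule borel_measurable_linear)

lemma orthogonal_transformation_reflection:
  assumes "\<alpha> \<noteq> 0"
  shows "orthogonal_transformation (reflection \<alpha>)"
  using assms by (simp add: orthogonal_transformation_def linear_reflection reflection_inner)

lemma reflection_involution:
  assumes "\<alpha> \<noteq> 0"
  shows "reflection \<alpha> (reflection \<alpha> x) = x"
proof -
  have "\<alpha> \<bullet> \<alpha> \<noteq> 0" using assms by simp
  then show ?thesis
    by (simp add: reflection_def inner_simps field_simps)
qed

lemma reflection_self:
  assumes "\<alpha> \<noteq> 0"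
  shows "reflection \<alpha> \<alpha> = - \<alpha>"
  using assms by (simp add: reflection_def scaleR_2)

lemma norm_reflection:
  assumes "\<alpha> \<noteq> 0"
  shows "norm (reflection \<alpha> x) = norm x"
  using orthogonal_transformation_norm[OF orthogonal_transformation_reflection[OF assms]] .

section \<open>The weighted measure\<close>

locale dunkl_setting =
  fixes R Rp :: "(real ^ 'n) set" and k :: "real ^ 'n \<Rightarrow> real"
  assumes normalized: "normalized_root_system R"
    and positive: "positive_subsystem R Rp"
    and multiplicity: "multiplicity_function R k"
begin

abbreviation \<mu> :: "(real ^ 'n) measure" where "\<mu> \<equiv> dunkl_measure Rp k"
abbreviation w :: "real ^ 'n \<Rightarrow> real" where "w \<equiv> dunkl_weight Rp k"
abbreviation \<gamma> :: real where "\<gamma> \<equiv> dunkl_gamma Rp k"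

text \<open>The homogeneous dimension: the measure \<open>\<mu>\<close> of a ball is proportional to this power of the radius.\<close>

definition hom_dim :: real where "hom_dim = real CARD('n) + 2 * \<gamma>"

lemma Rp_subset: "Rp \<subseteq> R"
  using positive by (auto simp: positive_subsystem_def)

lemma finite_Rp: "finite Rp"
  using normalized Rp_subset finite_subset
  by (auto simp: normalized_root_system_def root_system_def)

lemma root_nonzero: "\<alpha> \<in> R \<Longrightarrow> \<alpha> \<noteq> 0"
  using normalized by (auto simp: normalized_root_system_def root_system_def)

lemma root_inner_self: "\<alpha> \<in> R \<Longrightarrow> \<alpha> \<bullet> \<alpha> = 2"
  using normalized by (auto simp: normalized_root_system_def power2_norm_eq_inner)

lemma k_nonneg: "\<alpha> \<in> R \<Longrightarrow> 0 \<le> k \<alpha>"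
  using multiplicity by (auto simp: multiplicity_function_def)

lemma gamma_nonneg: "0 \<le> \<gamma>"
  unfolding dunkl_gamma_def using Rp_subset k_nonneg by (intro sum_nonneg) auto

lemma hom_dim_pos: "0 < hom_dim"
  using gamma_nonneg by (simp add: hom_dim_def add_pos_nonneg)

lemma k_reflection: "\<alpha> \<in> R \<Longrightarrow> \<beta> \<in> R \<Longrightarrow> k (reflection \<alpha> \<beta>) = k \<beta>"
  using multiplicity reflection_group.step[OF _ reflection_group.one, of \<alpha> R]
  by (auto simp: multiplicity_function_def)

lemma k_uminus: "\<alpha> \<in> R \<Longrightarrow> k (- \<alpha>) = k \<alpha>"
  using k_reflection[of \<alpha> \<alpha>] by (simp add: reflection_self root_nonzero)

text \<open>Opposite roots contribute equal factors.  In this form the weight no longer refers to the choice of \<open>Rp\<close>, and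
its reflection invariance becomes a permutation of factors.\<close>

lemma weight_eq_prod_all_roots: "w x = (\<Prod>\<alpha>\<in>R. \<bar>\<alpha> \<bullet> x\<bar> powr k \<alpha>)"
proof -
  have "(\<Prod>\<alpha>\<in>R. \<bar>\<alpha> \<bullet> x\<bar> powr k \<alpha>) =
      (\<Prod>\<alpha>\<in>Rp. \<bar>\<alpha> \<bullet> x\<bar> powr k \<alpha>) * (\<Prod>\<alpha>\<in>uminus ` Rp. \<bar>\<alpha> \<bullet> x\<bar> powr k \<alpha>)"
    using positive finite_Rp by (auto simp: positive_subsystem_def intro!: prod.union_disjoint)
  also have "(\<Prod>\<alpha>\<in>uminus ` Rp. \<bar>\<alpha> \<bullet> x\<bar> powr k \<alpha>) = (\<Prod>\<alpha>\<in>Rp. \<bar>\<alpha> \<bullet> x\<bar> powr k (- \<alpha>))"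
    by (subst prod.reindex) auto
  also have "\<dots> = (\<Prod>\<alpha>\<in>Rp. \<bar>\<alpha> \<bullet> x\<bar> powr k \<alpha>)"
    using Rp_subset by (intro prod.cong) (auto simp: k_uminus)
  finally have "(\<Prod>\<alpha>\<in>R. \<bar>\<alpha> \<bullet> x\<bar> powr k \<alpha>)
      = (\<Prod>\<alpha>\<in>Rp. \<bar>\<alpha> \<bullet> x\<bar> powr k \<alpha> * \<bar>\<alpha> \<bullet> x\<bar> powr k \<alpha>)"
    by (simp add: prod.distrib)
  then show ?thesis
    by (simp add: dunkl_weight_def powr_add[symmetric])
qed

lemma weight_reflection:
  assumes "\<beta> \<in> R"
  shows "w (reflection \<beta> x) = w x"
proof -
  have \<beta>: "\<beta> \<noteq> 0" using assms by (rule root_nonzero)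
  have im: "reflection \<beta> ` R = R"
    using assms normalized by (auto simp: normalized_root_system_def root_system_def)
  have inj: "inj_on (reflection \<beta>) R"
    by (metis inj_onI reflection_involution[OF \<beta>])
  have "w x = (\<Prod>\<alpha>\<in>reflection \<beta> ` R. \<bar>\<alpha> \<bullet> x\<bar> powr k \<alpha>)"
    by (simp add: weight_eq_prod_all_roots im)
  also have "\<dots> = (\<Prod>\<alpha>\<in>R. \<bar>reflection \<beta> \<alpha> \<bullet> x\<bar> powr k (reflection \<beta> \<alpha>))"
    by (simp add: prod.reindex[OF inj])
  also have "\<dots> = (\<Prod>\<alpha>\<in>R. \<bar>\<alpha> \<bullet> reflection \<beta> x\<bar> powr k \<alpha>)"
  proof (rule prod.cong)
    fix \<alpha> assume "\<alpha> \<in> R"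
    moreover have "reflection \<beta> \<alpha> \<bullet> x = \<alpha> \<bullet> reflection \<beta> x"
      using reflection_inner[OF \<beta>, of \<alpha> "reflection \<beta> x"] by (simp add: reflection_involution[OF \<beta>])
    ultimately show "\<bar>reflection \<beta> \<alpha> \<bullet> x\<bar> powr k (reflection \<beta> \<alpha>) = \<bar>\<alpha> \<bullet> reflection \<beta> x\<bar> powr k \<alpha>"
      using assms by (simp add: k_reflection)
  qed simp
  finally show ?thesis
    by (simp add: weight_eq_prod_all_roots)
qed

lemma weight_scale:
  assumes "0 < s"
  shows "w (s *\<^sub>R x) = s powr (2 * \<gamma>) * w x"
proof -
  have "w (s *\<^sub>R x) = (\<Prod>\<alpha>\<in>Rp. s powr (2 * k \<alpha>) * \<bar>\<alpha> \<bullet> x\<bar> powr (2 * k \<alpha>))"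
    unfolding dunkl_weight_def using assms by (intro prod.cong) (simp_all add: abs_mult powr_mult)
  also have "\<dots> = s powr (\<Sum>\<alpha>\<in>Rp. 2 * k \<alpha>) * w x"
    using assms finite_Rp by (simp add: prod.distrib dunkl_weight_def powr_sum)
  finally show ?thesis
    by (simp add: dunkl_gamma_def sum_distrib_left)
qed

lemma weight_nonneg: "0 \<le> w x"
  unfolding dunkl_weight_def by (intro prod_nonneg) auto

lemma weight_measurable [measurable]: "w \<in> borel_measurable borel"
  unfolding dunkl_weight_def by measurable

lemma sets_dunkl_measure [measurable_cong, simp]: "sets \<mu> = sets borel"
  by (simp add: dunkl_measure_def)

lemma space_dunkl_measure [simp]: "space \<mu> = UNIV"
  by (simp add: dunkl_measure_def)

lemma integral_dunkl_measure:
  fixes f :: "real ^ 'n \<Rightarrow> real"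
  assumes "f \<in> borel_measurable borel"
  shows "(LINT x|\<mu>. f x) = (LINT x|lborel. w x * f x)"
  unfolding dunkl_measure_def using assms weight_nonneg by (subst integral_density) auto

lemma integral_reflection:
  fixes f :: "real ^ 'n \<Rightarrow> real"
  assumes "\<beta> \<in> R" and [measurable]: "f \<in> borel_measurable borel"
  shows "(LINT x|\<mu>. f (reflection \<beta> x)) = (LINT x|\<mu>. f x)"
proof -
  have \<beta>: "\<beta> \<noteq> 0" using assms by (simp add: root_nonzero)
  have "(LINT x|\<mu>. f x) = (LINT x|distr lborel borel (reflection \<beta>). w x * f x)"
    by (simp add: integral_dunkl_measure
        distr_lborel_orthogonal_transformation[OF orthogonal_transformation_reflection[OF \<beta>]])
  also have "\<dots> = (LINT x|lborel. w (reflection \<beta> x) * f (reflection \<beta> x))"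
    by (rule integral_distr) measurable
  also have "\<dots> = (LINT x|\<mu>. f (reflection \<beta> x))"
    using assms by (simp add: weight_reflection integral_dunkl_measure)
  finally show ?thesis by simp
qed

lemma integral_scale:
  fixes f :: "real ^ 'n \<Rightarrow> real"
  assumes s: "0 < s" and [measurable]: "f \<in> borel_measurable borel"
  shows "(LINT x|\<mu>. f (s *\<^sub>R x)) = s powr (- hom_dim) * (LINT x|\<mu>. f x)"
proof -
  have "(LINT x|\<mu>. f x) = (LINT x|lborel. w x * f x)"
    by (simp add: integral_dunkl_measure)
  also have "\<dots> = (LINT x|density (distr lborel borel (\<lambda>x. 0 + s *\<^sub>R x)) (\<lambda>_. \<bar>s\<bar> ^ CARD('n)). w x * f x)"
    using lborel_affine[of s "0 :: real ^ 'n"] s by simp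
  also have "\<dots> = s ^ CARD('n) * (LINT x|distr lborel borel (\<lambda>x. 0 + s *\<^sub>R x). w x * f x)"
    using s by (subst integral_density) auto
  also have "(LINT x|distr lborel borel (\<lambda>x. 0 + s *\<^sub>R x). w x * f x)
      = (LINT x|lborel. w (s *\<^sub>R x) * f (s *\<^sub>R x))"
    by (subst integral_distr) auto
  also have "\<dots> = s powr (2 * \<gamma>) * (LINT x|\<mu>. f (s *\<^sub>R x))"
    using s by (simp add: weight_scale integral_dunkl_measure mult.assoc)
  finally have "(LINT x|\<mu>. f x) = s powr hom_dim * (LINT x|\<mu>. f (s *\<^sub>R x))"
    using s by (simp add: hom_dim_def powr_add powr_realpow)
  then show ?thesis
    using s by (simp add: powr_minus field_simps)
qed

lemma weight_bounded_on_ball: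
  assumes "norm x \<le> r"
  shows "w x \<le> (\<Prod>\<alpha>\<in>Rp. (norm \<alpha> * r) powr (2 * k \<alpha>))"
  unfolding dunkl_weight_def
proof (rule prod_mono, safe)
  fix \<alpha> assume "\<alpha> \<in> Rp"
  then have "0 \<le> k \<alpha>" using Rp_subset k_nonneg by auto
  moreover have "\<bar>\<alpha> \<bullet> x\<bar> \<le> norm \<alpha> * r"
    using Cauchy_Schwarz_ineq2[of \<alpha> x] assms by (meson mult_left_mono norm_ge_zero order_trans)
  ultimately show "\<bar>\<alpha> \<bullet> x\<bar> powr (2 * k \<alpha>) \<le> (norm \<alpha> * r) powr (2 * k \<alpha>)"
    by (intro powr_mono2) auto
qed simp

lemma emeasure_cball_finite: "emeasure \<mu> (cball 0 r) < \<infinity>"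
proof -
  define M where "M = (\<Prod>\<alpha>\<in>Rp. (norm \<alpha> * r) powr (2 * k \<alpha>))"
  have "emeasure \<mu> (cball 0 r) = (\<integral>\<^sup>+x. ennreal (w x) * indicator (cball 0 r) x \<partial>lborel)"
    unfolding dunkl_measure_def by (subst emeasure_density) auto
  also have "\<dots> \<le> (\<integral>\<^sup>+x. ennreal M * indicator (cball (0 :: real ^ 'n) r) x \<partial>lborel)"
  proof (rule nn_integral_mono)
    fix x :: "real ^ 'n"
    show "ennreal (w x) * indicator (cball 0 r) x \<le> ennreal M * indicator (cball 0 r) x"
      using weight_bounded_on_ball[of x r] by (auto simp: indicator_def M_def intro: ennreal_leI)
  qed
  also have "\<dots> = ennreal M * emeasure lborel (cball (0::real^'n) r)"
    by (subst nn_integral_cmult_indicator) auto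
  also have "\<dots> < \<infinity>"
    using emeasure_lborel_cball_finite[of "0::real^'n" r] by (simp add: ennreal_mult_less_top)
  finally show ?thesis .
qed

lemma integrable_indicator_cball: "integrable \<mu> (indicator (cball 0 r) :: real ^ 'n \<Rightarrow> real)"
  using emeasure_cball_finite[of r] by (intro integrable_real_indicator) auto

lemma integrable_bounded_support:
  fixes f :: "real ^ 'n \<Rightarrow> real"
  assumes [measurable]: "f \<in> borel_measurable borel"
    and bound: "\<And>x. \<bar>f x\<bar> \<le> B" and zero: "\<And>x. r < norm x \<Longrightarrow> f x = 0"
  shows "integrable \<mu> f"
proof (rule Bochner_Integration.integrable_bound)
  show "integrable \<mu> (\<lambda>x. B * indicator (cball 0 r) x)"
    using integrable_indicator_cball by simp
  show "AE x in \<mu>. norm (f x) \<le> norm (B * indicator (cball 0 r) x)"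
  proof (rule AE_I2)
    fix x
    show "norm (f x) \<le> norm (B * indicator (cball 0 r) x)"
      using bound[of x] zero[of x] by (cases "norm x \<le> r") auto
  qed
qed simp

end

section \<open>Euler's identity in integrated form\<close>

text \<open>The derivative of a power at 1, along the same sequence of dilations as in the next lemma.\<close>

lemma powr_difference_quotient_at_1:
  "(\<lambda>n. ((1 + 1 / real (Suc n)) powr a - 1) * real (Suc n)) \<longlonglongrightarrow> a"
proof -
  have "((\<lambda>t. t powr a) has_real_derivative a) (at 1)"
    using has_real_derivative_powr[of 1 a] by simp
  then have lim: "(\<lambda>h. ((1 + h) powr a - 1) / h) \<midarrow>0\<rightarrow> a"
    by (simp add: DERIV_def)
  have "filterlim (\<lambda>n. 1 / real (Suc n)) (at 0) sequentially"
    using LIMSEQ_inverse_real_of_nat by (simp add: filterlim_at inverse_eq_divide)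
  from filterlim_compose[OF lim this] show ?thesis
    by simp
qed

lemma directional_difference_quotient:
  fixes \<psi> :: "'a::real_normed_vector \<Rightarrow> real"
  assumes "(\<psi> has_derivative D) (at x)"
  shows "(\<lambda>n. (\<psi> (x + (1 / real (Suc n)) *\<^sub>R h) - \<psi> x) * real (Suc n)) \<longlonglongrightarrow> D h"
proof -
  have D: "bounded_linear D"
    using assms by (rule has_derivative_bounded_linear)
  have "((\<lambda>t. \<psi> (x + t *\<^sub>R h)) has_derivative (\<lambda>t. D (t *\<^sub>R h))) (at 0)"
    by (rule has_derivative_compose[of "\<lambda>t. x + t *\<^sub>R h"])
       (use assms in \<open>auto intro!: derivative_eq_intros\<close>)
  then have "((\<lambda>t. \<psi> (x + t *\<^sub>R h)) has_real_derivative D h) (at 0)"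
    by (simp add: has_field_derivative_def linear_scale[OF bounded_linear.linear[OF D]] mult_commute_abs)
  then have lim: "(\<lambda>t. (\<psi> (x + t *\<^sub>R h) - \<psi> x) / t) \<midarrow>0\<rightarrow> D h"
    by (simp add: DERIV_def)
  have "filterlim (\<lambda>n. 1 / real (Suc n)) (at 0) sequentially"
    using LIMSEQ_inverse_real_of_nat by (simp add: filterlim_at inverse_eq_divide)
  from filterlim_compose[OF lim this] show ?thesis
    by simp
qed

context dunkl_setting
begin

text \<open>Both sides are the limit of the integrals of the difference quotients \<open>(\<psi> (s x) - \<psi> x) / (s - 1)\<close> as
\<open>s\<close> decreases to 1.  On the right, this is the derivative at \<open>s = 1\<close> of \<open>s powr (- hom_dim)\<close>; on the
left, the quotients are dominated by \<open>L r\<close> on the ball of radius \<open>r\<close>, and dilation by \<open>s > 1\<close>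
does not bring the support outside of it.\<close>

lemma euler_identity:
  fixes \<psi> :: "real ^ 'n \<Rightarrow> real" and D :: "real ^ 'n \<Rightarrow> real ^ 'n \<Rightarrow> real"
  assumes der: "\<And>x. (\<psi> has_derivative D x) (at x)"
    and lip: "\<And>x y. \<bar>\<psi> x - \<psi> y\<bar> \<le> L * norm (x - y)"
    and zero: "\<And>x. r < norm x \<Longrightarrow> \<psi> x = 0"
  shows "(LINT x|\<mu>. D x x) = - hom_dim * (LINT x|\<mu>. \<psi> x)"
proof -
  define s :: "nat \<Rightarrow> real" where "s n = 1 + 1 / real (Suc n)" for n
  define F where "F n x = (\<psi> (s n *\<^sub>R x) - \<psi> x) * real (Suc n)" for n x
  have s: "1 < s n" for n by (simp add: s_def)
  have L: "0 \<le> L"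
    using lip[of "axis undefined 1" 0] by (auto simp: norm_axis_1 intro: order_trans[OF abs_ge_zero])
  have cont: "continuous_on UNIV \<psi>"
    using der by (intro differentiable_imp_continuous_on)
      (auto simp: differentiable_on_def differentiable_def intro: has_derivative_at_withinI)
  have [measurable]: "\<psi> \<in> borel_measurable borel"
    using cont by (rule borel_measurable_continuous_onI)
  have F_lim: "(\<lambda>n. F n x) \<longlonglongrightarrow> D x x" for x
    using directional_difference_quotient[OF der, of x x]
    by (simp add: F_def s_def scaleR_left_distrib)
  have F_bound: "\<bar>F n x\<bar> \<le> L * r * indicator (cball 0 r) x" for n x
  proof (cases "norm x \<le> r")
    case True
    have "\<bar>\<psi> (s n *\<^sub>R x) - \<psi> x\<bar> \<le> L * norm (s n *\<^sub>R x - x)"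
      by (rule lip)
    also have "s n *\<^sub>R x - x = (1 / real (Suc n)) *\<^sub>R x"
      by (simp add: s_def scaleR_left_distrib)
    also have "L * norm \<dots> \<le> L * r / real (Suc n)"
      using True L by (simp add: divide_right_mono mult_left_mono)
    finally show ?thesis
      using True by (simp add: F_def abs_mult pos_le_divide_eq del: of_nat_Suc)
  next
    case False
    moreover have "norm x \<le> norm (s n *\<^sub>R x)"
      using s[of n] by (simp add: mult_le_cancel_right1)
    ultimately have "r < norm (s n *\<^sub>R x)" "r < norm x" by linarith+
    then show ?thesis
      by (simp add: F_def zero del: norm_scaleR)
  qed
  have [measurable]: "F n \<in> borel_measurable borel" for n
    unfolding F_def by measurable
  have [measurable]: "(\<lambda>x. D x x) \<in> borel_measurable borel"
    by (rule borel_measurable_LIMSEQ_real[OF F_lim]) measurable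
  have int_\<psi>: "integrable \<mu> \<psi>"
  proof (rule integrable_bounded_support)
    \<comment> \<open>The Lipschitz bound relative to a point \<open>y\<close> outside the support bounds \<open>\<psi>\<close> itself.\<close>
    obtain y :: "real ^ 'n" where y: "norm y = \<bar>r\<bar> + 1"
      using vector_choose_size[of "\<bar>r\<bar> + 1"] by auto
    show "\<bar>\<psi> x\<bar> \<le> L * (2 * \<bar>r\<bar> + 1)" for x
    proof (cases "norm x \<le> r")
      case True
      have "\<psi> y = 0" using zero[of y] y by simp
      then have "\<bar>\<psi> x\<bar> \<le> L * norm (x - y)"
        using lip[of x y] by simp
      also have "\<dots> \<le> L * (2 * \<bar>r\<bar> + 1)"
        using True y norm_triangle_ineq4[of x y] L by (intro mult_left_mono) linarith+
      finally show ?thesis .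
    next
      case False
      then show ?thesis using zero L by simp
    qed
    show "r < norm x \<Longrightarrow> \<psi> x = 0" for x by (rule zero)
  qed measurable
  have int_F: "integrable \<mu> (F n)" for n
    by (rule Bochner_Integration.integrable_bound[where f = "\<lambda>x. L * r * indicator (cball 0 r) x"])
       (auto intro!: AE_I2 integrable_indicator_cball order_trans[OF F_bound])
  have LINT_F: "(LINT x|\<mu>. F n x) = (s n powr (- hom_dim) - 1) * real (Suc n) * (LINT x|\<mu>. \<psi> x)" for n
  proof -
    have sc: "integrable \<mu> (\<lambda>x. \<psi> (s n *\<^sub>R x))"
    proof -
      have "integrable \<mu> (\<lambda>x. F n x * (1 / real (Suc n)) + \<psi> x)"
        using int_F int_\<psi> by (intro Bochner_Integration.integrable_add integrable_mult_left) auto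
      then show ?thesis by (simp add: F_def del: of_nat_Suc)
    qed
    then have "(LINT x|\<mu>. F n x) = ((LINT x|\<mu>. \<psi> (s n *\<^sub>R x)) - (LINT x|\<mu>. \<psi> x)) * real (Suc n)"
      using int_\<psi> by (simp add: F_def)
    also have "(LINT x|\<mu>. \<psi> (s n *\<^sub>R x)) = s n powr (- hom_dim) * (LINT x|\<mu>. \<psi> x)"
      using s[of n] by (intro integral_scale) auto
    finally show ?thesis by (simp add: algebra_simps)
  qed
  have "(\<lambda>n. LINT x|\<mu>. F n x) \<longlonglongrightarrow> (LINT x|\<mu>. D x x)"
  proof (rule integral_dominated_convergence)
    show "integrable \<mu> (\<lambda>x. L * r * indicator (cball 0 r) x)"
      using integrable_indicator_cball by simp
  qed (use F_lim F_bound in auto)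
  moreover have "(\<lambda>n. LINT x|\<mu>. F n x) \<longlonglongrightarrow> - hom_dim * (LINT x|\<mu>. \<psi> x)"
    unfolding LINT_F s_def by (intro tendsto_mult powr_difference_quotient_at_1 tendsto_const)
  ultimately show ?thesis
    by (rule LIMSEQ_unique)
qed

end

section \<open>Odd powers\<close>

text \<open>Up to the factor \<open>p\<close>, the derivative of \<open>|t| powr p\<close> is this odd function with \<open>a = p - 1\<close>.\<close>

definition signed_powr :: "real \<Rightarrow> real \<Rightarrow> real" where
  "signed_powr t a = sgn t * \<bar>t\<bar> powr a"

lemma has_real_derivative_abs_powr:
  assumes "1 < p"
  shows "((\<lambda>t. \<bar>t\<bar> powr p) has_real_derivative p * signed_powr t (p - 1)) (at t)"
proof -
  consider "0 < t" | "t < 0" | "t = 0" by linarith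
  then show ?thesis
  proof cases
    case 1
    then have "((\<lambda>t. t powr p) has_real_derivative p * signed_powr t (p - 1)) (at t)"
      using has_real_derivative_powr[of t p] by (simp add: signed_powr_def)
    then show ?thesis
      by (rule has_field_derivative_transform_within_open[of _ _ _ "{0<..}"]) (use 1 in auto)
  next
    case 2
    then have "((\<lambda>t. (- t) powr p) has_real_derivative p * signed_powr t (p - 1)) (at t)"
      by (auto intro!: derivative_eq_intros simp: signed_powr_def)
    then show ?thesis
      by (rule has_field_derivative_transform_within_open[of _ _ _ "{..<0}"]) (use 2 in auto)
  next
    case 3
    have "((\<lambda>h. \<bar>h\<bar> powr (p - 1)) \<longlongrightarrow> 0 powr (p - 1)) (at 0)"
      using assms by (intro tendsto_powr2 tendsto_rabs_zero) (auto intro!: tendsto_eq_intros)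
    then have "((\<lambda>h. \<bar>h\<bar> powr (p - 1)) \<longlongrightarrow> 0) (at 0)"
      using assms by simp
    then have "((\<lambda>h. \<bar>h\<bar> powr p / h) \<longlongrightarrow> 0) (at 0)"
    proof (rule Lim_null_comparison[rotated])
      show "\<forall>\<^sub>F h in at 0. norm (\<bar>h\<bar> powr p / h) \<le> \<bar>h\<bar> powr (p - 1)"
        by (rule eventuallyI) (simp add: powr_diff)
    qed
    then show ?thesis
      using 3 by (simp add: DERIV_def signed_powr_def)
  qed
qed

lemma signed_powr_mult_self:
  "signed_powr t (p - 1) * t = \<bar>t\<bar> powr p"
proof (cases "t = 0")
  case False
  then show ?thesis
    by (simp add: signed_powr_def powr_diff) (simp add: mult.assoc mult.left_commute abs_sgn[symmetric] field_simps)
qed (simp add: signed_powr_def)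

lemma abs_signed_powr: "0 \<le> a \<Longrightarrow> \<bar>signed_powr t a\<bar> = \<bar>t\<bar> powr a"
  by (simp add: signed_powr_def abs_mult abs_sgn_eq)

lemma signed_powr_mono:
  fixes s t a :: real
  assumes "0 \<le> a" "s \<le> t"
  shows "signed_powr s a \<le> signed_powr t a"
proof -
  consider "0 \<le> s" | "t \<le> 0" | "s < 0" "0 < t" by linarith
  then show ?thesis
  proof cases
    case 1
    then show ?thesis using assms
      by (cases "s = 0") (auto simp: signed_powr_def sgn_if intro: powr_mono2)
  next
    case 2
    then show ?thesis using assms
      by (cases "t = 0") (auto simp: signed_powr_def sgn_if intro: powr_mono2)
  next
    case 3
    then show ?thesis
      by (simp add: signed_powr_def) (meson neg_0_le_iff_le order_trans powr_ge_zero neg_le_0_iff_le)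
  qed
qed

text \<open>Monotonicity in the symmetric form in which the reflection terms produce it.\<close>

lemma signed_powr_monotone_product:
  fixes s t a :: real
  assumes "0 \<le> a"
  shows "0 \<le> (signed_powr s a - signed_powr t a) * (s - t)"
  using signed_powr_mono[OF assms, of s t] signed_powr_mono[OF assms, of t s]
  by (cases "s \<le> t") (auto simp: zero_le_mult_iff)

lemma abs_powr_lipschitz:
  fixes s t M p :: real
  assumes p: "1 < p" and "\<bar>s\<bar> \<le> M" "\<bar>t\<bar> \<le> M"
  shows "\<bar>\<bar>s\<bar> powr p - \<bar>t\<bar> powr p\<bar> \<le> p * M powr (p - 1) * \<bar>s - t\<bar>"
proof -
  have "norm (\<bar>s\<bar> powr p - \<bar>t\<bar> powr p) \<le> p * M powr (p - 1) * norm (s - t)"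
  proof (rule field_differentiable_bound[of "{-M..M}" _ "\<lambda>t. p * signed_powr t (p - 1)"])
    fix z assume "z \<in> {-M..M}"
    then show "norm (p * signed_powr z (p - 1)) \<le> p * M powr (p - 1)"
      using p by (auto simp: abs_mult abs_signed_powr intro!: powr_mono2)
    show "((\<lambda>t. \<bar>t\<bar> powr p) has_field_derivative p * signed_powr z (p - 1)) (at z within {-M..M})"
      using has_real_derivative_abs_powr[OF p] by (rule has_field_derivative_at_within)
  qed (use assms in auto)
  then show ?thesis by simp
qed

text \<open>Taken with the weights that produce \<open>a powr p\<close> from \<open>a powr (p - 1)\<close>; it is used pointwise under the
integral in place of Hoelder's inequality.\<close>

lemma Young_powr:
  fixes a b p :: real
  assumes "1 < p" "0 \<le> a" "0 \<le> b"
  shows "a powr (p - 1) * b \<le> (p - 1) / p * a powr p + b powr p / p"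
proof -
  have "b * a powr (p - 1) \<le> b powr p / p + (a powr (p - 1)) powr (p / (p - 1)) / (p / (p - 1))"
    using assms by (intro Youngs_inequality) (auto simp: field_simps)
  also have "(a powr (p - 1)) powr (p / (p - 1)) = a powr p"
    using assms by (simp add: powr_powr)
  finally show ?thesis
    using assms by (simp add: field_simps)
qed

section \<open>Test functions and their gradients\<close>

definition gradient :: "(real ^ 'n \<Rightarrow> real) \<Rightarrow> real ^ 'n \<Rightarrow> real ^ 'n" where
  "gradient u x = (\<chi> i. partial_derivative i u x)"

lemma frechet_derivative_eq_gradient:
  fixes u :: "real ^ 'n \<Rightarrow> real"
  assumes "u differentiable (at x)"
  shows "frechet_derivative u (at x) h = gradient u x \<bullet> h"
proof -
  have lin: "linear (frechet_derivative u (at x))"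
    using assms by (rule linear_frechet_derivative)
  have "h = (\<Sum>i\<in>UNIV. h $ i *\<^sub>R axis i 1)"
    using basis_expansion[of h] by (simp add: scalar_mult_eq_scaleR)
  then have "frechet_derivative u (at x) h = frechet_derivative u (at x) (\<Sum>i\<in>UNIV. h $ i *\<^sub>R axis i 1)"
    by simp
  also have "\<dots> = (\<Sum>i\<in>UNIV. h $ i * frechet_derivative u (at x) (axis i 1))"
    by (simp add: linear_sum[OF lin] linear_scale[OF lin])
  finally show ?thesis
    by (simp add: gradient_def partial_derivative_def inner_vec_def mult.commute)
qed

lemma has_derivative_gradient:
  fixes u :: "real ^ 'n \<Rightarrow> real"
  assumes "u differentiable (at x)"
  shows "(u has_derivative (\<lambda>h. gradient u x \<bullet> h)) (at x)"
  using assms frechet_derivative_works[of u "at x"] frechet_derivative_eq_gradient[OF assms]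
  by (metis (no_types, lifting) ext)

lemma gradient_eqI:
  fixes u :: "real ^ 'n \<Rightarrow> real"
  assumes "(u has_derivative (\<lambda>h. g \<bullet> h)) (at x)"
  shows "gradient u x = g"
proof -
  have "frechet_derivative u (at x) = (\<lambda>h. g \<bullet> h)"
    using assms by (rule frechet_derivative_at[symmetric])
  then show ?thesis
    by (simp add: gradient_def partial_derivative_def vec_eq_iff inner_axis)
qed

lemma gradient_eq_0_if_locally_0:
  fixes u :: "real ^ 'n \<Rightarrow> real"
  assumes "open S" "x \<in> S" "\<And>y. y \<in> S \<Longrightarrow> u y = 0"
  shows "gradient u x = 0"
proof (rule gradient_eqI)
  have "((\<lambda>_. 0) has_derivative (\<lambda>h. 0 \<bullet> h)) (at x)"
    by simp
  then show "(u has_derivative (\<lambda>h. 0 \<bullet> h)) (at x)"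
    by (rule has_derivative_transform_within_open[OF _ assms(1,2)]) (simp add: assms(3))
qed

lemma lipschitz_if_derivative_bounded:
  fixes f :: "real ^ 'n \<Rightarrow> real"
  assumes "\<And>x. (f has_derivative D x) (at x)" "\<And>x h. \<bar>D x h\<bar> \<le> L * norm h"
  shows "\<bar>f x - f y\<bar> \<le> L * norm (x - y)"
proof -
  have "norm (f x - f y) \<le> L * norm (x - y)"
  proof (rule differentiable_bound[of UNIV f D])
    show "onorm (D z) \<le> L" for z
      using assms(2)[of z] by (intro onorm_le) auto
  qed (use assms(1) in auto)
  then show ?thesis by simp
qed

locale test_function =
  fixes u :: "real ^ 'n \<Rightarrow> real"
  assumes test: "u \<in> test_functions_off_origin"
begin

lemma differentiable: "u differentiable (at x)"
  using test unfolding test_functions_off_origin_def smooth_def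
  by (metis (mono_tags, lifting) mem_Collect_eq times_continuously_differentiable.simps(2))

lemma continuous_partial_derivative: "continuous_on UNIV (partial_derivative i u)"
  using test unfolding test_functions_off_origin_def smooth_def
  by (metis (mono_tags, lifting) mem_Collect_eq times_continuously_differentiable.simps)

lemma continuous: "continuous_on UNIV u"
  using differentiable by (intro differentiable_imp_continuous_on)
    (auto simp: differentiable_on_def intro: differentiable_at_withinI)

lemma continuous_gradient: "continuous_on UNIV (gradient u)"
  unfolding gradient_def[abs_def] by (intro continuous_on_vec_lambda continuous_partial_derivative)

lemma measurable_test_function [measurable]: "u \<in> borel_measurable borel" "gradient u \<in> borel_measurable borel"
  using continuous continuous_gradient by (auto intro: borel_measurable_continuous_onI)

lemma support_annulus:
  obtains \<delta> r where "0 < \<delta>" "\<And>x. norm x < \<delta> \<Longrightarrow> u x = 0" "\<And>x. r < norm x \<Longrightarrow> u x = 0"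
proof -
  let ?S = "closure {x. u x \<noteq> 0}"
  have S: "compact ?S" "0 \<notin> ?S"
    using test by (auto simp: test_functions_off_origin_def)
  have sub: "u x = 0" if "x \<notin> ?S" for x
    using that closure_subset[of "{x. u x \<noteq> 0}"] by auto
  obtain r where r: "\<And>x. x \<in> ?S \<Longrightarrow> norm x \<le> r"
    using compact_imp_bounded[OF S(1)] by (auto simp: bounded_iff)
  have "open (- ?S)" "0 \<in> - ?S"
    using S by auto
  then obtain \<delta> where "0 < \<delta>" "ball 0 \<delta> \<subseteq> - ?S"
    by (meson open_contains_ball)
  then have "norm x < \<delta> \<Longrightarrow> u x = 0" for x
    using sub[of x] by auto
  moreover have "r < norm x \<Longrightarrow> u x = 0" for x
    using sub[of x] r[of x] by force
  ultimately show thesis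
    using that \<open>0 < \<delta>\<close> by blast
qed

lemma bounded_gradient:
  obtains L where "0 \<le> L" "\<And>x. norm (gradient u x) \<le> L"
proof -
  obtain \<delta> r where r: "\<And>x. r < norm x \<Longrightarrow> u x = 0"
    using support_annulus by metis
  have "compact (gradient u ` cball 0 r)"
    using continuous_gradient by (intro compact_continuous_image) (auto intro: continuous_on_subset)
  then obtain L where L: "\<And>x. norm x \<le> r \<Longrightarrow> norm (gradient u x) \<le> L"
    by (fastforce dest: compact_imp_bounded simp: bounded_iff)
  have "norm (gradient u x) \<le> max 0 L" for x
  proof (cases "norm x \<le> r")
    case False
    have "open {y::real^'n. r < norm y}"
      by (intro open_Collect_less continuous_intros)
    then have "gradient u x = 0"
      using False r by (intro gradient_eq_0_if_locally_0[of "{y. r < norm y}"]) auto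
    then show ?thesis by simp
  qed (use L[of x] in auto)
  then show thesis
    using that[of "max 0 L"] by simp
qed

lemma lipschitz:
  assumes "\<And>x. norm (gradient u x) \<le> L"
  shows "\<bar>u x - u y\<bar> \<le> L * norm (x - y)"
proof (rule lipschitz_if_derivative_bounded)
  show "(u has_derivative (\<lambda>h. gradient u z \<bullet> h)) (at z)" for z
    by (rule has_derivative_gradient[OF differentiable])
  show "\<bar>gradient u z \<bullet> h\<bar> \<le> L * norm h" for z h
    using Cauchy_Schwarz_ineq2[of "gradient u z" h] assms[of z]
    by (meson mult_right_mono norm_ge_zero order_trans)
qed

lemma bounded:
  obtains M where "0 \<le> M" "\<And>x. \<bar>u x\<bar> \<le> M"
proof -
  obtain \<delta> r where r: "\<And>x. r < norm x \<Longrightarrow> u x = 0"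
    using support_annulus by metis
  have "compact (u ` cball 0 r)"
    using continuous by (intro compact_continuous_image) (auto intro: continuous_on_subset)
  then obtain M where M: "\<And>x. norm x \<le> r \<Longrightarrow> \<bar>u x\<bar> \<le> M"
    by (fastforce dest: compact_imp_bounded simp: bounded_iff)
  have "\<bar>u x\<bar> \<le> max 0 M" for x
    using M[of x] r[of x] by (cases "norm x \<le> r") auto
  then show thesis
    using that[of "max 0 M"] by simp
qed

text \<open>No case distinction is needed in the conclusion: at the origin, both sides vanish because the test function is
zero nearby and division by zero yields zero.\<close>

lemma quotient_by_norm_has_derivative:
  "((\<lambda>x. u x / norm x) has_derivative
     (\<lambda>h. (gradient u x \<bullet> h) / norm x - u x * (x \<bullet> h) / norm x ^ 3)) (at x)"
proof (cases "x = 0")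
  case True
  obtain \<delta> r where \<delta>: "0 < \<delta>" "\<And>x. norm x < \<delta> \<Longrightarrow> u x = 0"
    using support_annulus by metis
  have "((\<lambda>x::real^'n. 0::real) has_derivative (\<lambda>h. 0)) (at x)"
    by simp
  then have "((\<lambda>x. u x / norm x) has_derivative (\<lambda>h. 0)) (at x)"
    by (rule has_derivative_transform_within_open[where s = "ball 0 \<delta>"]) (use \<delta> True in auto)
  then show ?thesis
    using True by simp
next
  case False
  have "((\<lambda>x. u x * inverse (norm x)) has_derivative
      (\<lambda>h. u x * - (inverse (norm x) * (sgn x \<bullet> h) * inverse (norm x)) + (gradient u x \<bullet> h) * inverse (norm x))) (at x)"
    using False has_derivative_norm[of x]
    by (intro has_derivative_mult has_derivative_gradient[OF differentiable] Deriv.has_derivative_inverse)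
       (auto simp: inner_commute)
  moreover have "(\<lambda>h. u x * - (inverse (norm x) * (sgn x \<bullet> h) * inverse (norm x)) + (gradient u x \<bullet> h) * inverse (norm x))
      = (\<lambda>h. (gradient u x \<bullet> h) / norm x - u x * (x \<bullet> h) / norm x ^ 3)"
    using False by (auto simp: fun_eq_iff sgn_div_norm divide_simps power3_eq_cube)
  ultimately show ?thesis
    by (simp only: divide_inverse[symmetric])
qed

lemma quotient_by_norm_lipschitz:
  obtains K where "0 \<le> K" "\<And>x y. \<bar>u x / norm x - u y / norm y\<bar> \<le> K * norm (x - y)"
proof -
  obtain \<delta> r where \<delta>: "0 < \<delta>" "\<And>x. norm x < \<delta> \<Longrightarrow> u x = 0"
    using support_annulus by metis
  obtain L where L: "0 \<le> L" "\<And>x. norm (gradient u x) \<le> L"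
    using bounded_gradient by metis
  obtain M where M: "0 \<le> M" "\<And>x. \<bar>u x\<bar> \<le> M"
    using bounded by metis
  have bound: "\<bar>(gradient u x \<bullet> h) / norm x - u x * (x \<bullet> h) / norm x ^ 3\<bar> \<le> (L / \<delta> + M / \<delta>\<^sup>2) * norm h" for x h
  proof (cases "norm x < \<delta>")
    case True
    then have "gradient u x = 0"
      using \<delta> by (intro gradient_eq_0_if_locally_0[of "ball 0 \<delta>"]) auto
    then show ?thesis
      using True \<delta> L M by simp
  next
    case False
    then have x: "0 < norm x" "\<delta> \<le> norm x" using \<delta> by auto
    have "\<bar>gradient u x \<bullet> h\<bar> \<le> L * norm h"
      using Cauchy_Schwarz_ineq2[of "gradient u x" h] L(2)[of x]
      by (meson mult_right_mono norm_ge_zero order_trans)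
    then have 1: "\<bar>(gradient u x \<bullet> h) / norm x\<bar> \<le> L * norm h / \<delta>"
      using x \<delta> L by (auto intro!: frac_le)
    have "\<bar>u x * (x \<bullet> h) / norm x ^ 3\<bar> \<le> M * (norm x * norm h) / norm x ^ 3"
      using Cauchy_Schwarz_ineq2[of x h] M
      by (auto simp: abs_mult intro!: divide_right_mono mult_mono)
    also have "\<dots> = M * norm h / (norm x)\<^sup>2"
      using x by (simp add: power2_eq_square power3_eq_cube)
    also have "\<dots> \<le> M * norm h / \<delta>\<^sup>2"
      using x \<delta> M by (intro frac_le power_mono) auto
    finally have 2: "\<bar>u x * (x \<bullet> h) / norm x ^ 3\<bar> \<le> M * norm h / \<delta>\<^sup>2" .
    have "\<bar>(gradient u x \<bullet> h) / norm x - u x * (x \<bullet> h) / norm x ^ 3\<bar> \<le> L * norm h / \<delta> + M * norm h / \<delta>\<^sup>2"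
      using 1 2 by linarith
    then show ?thesis
      by (simp add: distrib_right)
  qed
  have "\<bar>u x / norm x - u y / norm y\<bar> \<le> (L / \<delta> + M / \<delta>\<^sup>2) * norm (x - y)" for x y
    by (rule lipschitz_if_derivative_bounded[OF quotient_by_norm_has_derivative bound])
  then show thesis
    using that[of "L / \<delta> + M / \<delta>\<^sup>2"] L M \<delta> by simp
qed

lemma quotient_by_norm_bounded:
  obtains K where "0 \<le> K" "\<And>x. \<bar>u x / norm x\<bar> \<le> K"
proof -
  obtain \<delta> r where \<delta>: "0 < \<delta>" "\<And>x. norm x < \<delta> \<Longrightarrow> u x = 0"
    using support_annulus by metis
  obtain M where M: "0 \<le> M" "\<And>x. \<bar>u x\<bar> \<le> M"
    using bounded by metis
  have "\<bar>u x / norm x\<bar> \<le> M / \<delta>" for x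
    using \<delta> M by (cases "norm x < \<delta>") (auto intro!: frac_le)
  then show thesis
    using that[of "M / \<delta>"] M \<delta> by simp
qed

end

section \<open>The Hardy inequality\<close>

locale dunkl_test_function = dunkl_setting R Rp k + test_function u
  for R Rp :: "(real ^ 'n) set" and k :: "real ^ 'n \<Rightarrow> real" and u :: "real ^ 'n \<Rightarrow> real"
begin

lemma dunkl_gradient_eq:
  "dunkl_gradient Rp k u x =
     gradient u x + (\<Sum>\<alpha>\<in>Rp. (k \<alpha> * ((u x - u (reflection \<alpha> x)) / (\<alpha> \<bullet> x))) *\<^sub>R \<alpha>)"
  by (simp add: dunkl_gradient_def dunkl_operator_def gradient_def vec_eq_iff mult_ac)

text \<open>In the radial direction the singular denominators cancel.  On a hyperplane \<open>\<alpha> \<bullet> x = 0\<close> the reflection fixes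
\<open>x\<close>, so the identity holds there as well.\<close>

lemma inner_dunkl_gradient:
  "x \<bullet> dunkl_gradient Rp k u x = x \<bullet> gradient u x + (\<Sum>\<alpha>\<in>Rp. k \<alpha> * (u x - u (reflection \<alpha> x)))"
proof -
  have "x \<bullet> ((k \<alpha> * ((u x - u (reflection \<alpha> x)) / (\<alpha> \<bullet> x))) *\<^sub>R \<alpha>) = k \<alpha> * (u x - u (reflection \<alpha> x))" for \<alpha>
    by (cases "\<alpha> \<bullet> x = 0") (simp_all add: reflection_def inner_commute)
  then show ?thesis
    by (simp add: dunkl_gradient_eq inner_add_right inner_sum_right)
qed

lemma measurable_dunkl_gradient [measurable]: "dunkl_gradient Rp k u \<in> borel_measurable borel"
  unfolding dunkl_gradient_eq[abs_def] by measurable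

text \<open>The distance of \<open>x\<close> to its mirror image is proportional to \<open>|\<alpha> \<bullet> x|\<close>, so the Lipschitz constant of
\<open>u\<close> bounds the difference quotients.\<close>

lemma dunkl_gradient_bounded:
  obtains B where "0 \<le> B" "\<And>x. norm (dunkl_gradient Rp k u x) \<le> B"
proof -
  obtain L where L: "0 \<le> L" "\<And>x. norm (gradient u x) \<le> L"
    using bounded_gradient by metis
  have quotient: "norm ((k \<alpha> * ((u x - u (reflection \<alpha> x)) / (\<alpha> \<bullet> x))) *\<^sub>R \<alpha>) \<le> k \<alpha> * (2 * L)"
    if "\<alpha> \<in> Rp" for \<alpha> x
  proof (cases "\<alpha> \<bullet> x = 0")
    case True
    then show ?thesis using that k_nonneg Rp_subset L by auto
  next
    case False
    have \<alpha>: "\<alpha> \<bullet> \<alpha> = 2" "0 \<le> k \<alpha>"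
      using that Rp_subset root_inner_self k_nonneg by auto
    then have n: "norm \<alpha> * norm \<alpha> = 2"
      by (metis power2_norm_eq_inner power2_eq_square)
    have "\<bar>u x - u (reflection \<alpha> x)\<bar> \<le> L * norm (x - reflection \<alpha> x)"
      by (rule lipschitz[OF L(2)])
    also have "\<dots> = L * (\<bar>\<alpha> \<bullet> x\<bar> * norm \<alpha>)"
      by (simp add: reflection_def \<alpha>)
    finally have "\<bar>u x - u (reflection \<alpha> x)\<bar> / \<bar>\<alpha> \<bullet> x\<bar> \<le> L * norm \<alpha>"
      using False by (simp add: field_simps)
    then have "\<bar>u x - u (reflection \<alpha> x)\<bar> / \<bar>\<alpha> \<bullet> x\<bar> * norm \<alpha> \<le> L * norm \<alpha> * norm \<alpha>"
      by (rule mult_right_mono) simp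
    then have "k \<alpha> * (\<bar>u x - u (reflection \<alpha> x)\<bar> / \<bar>\<alpha> \<bullet> x\<bar> * norm \<alpha>) \<le> k \<alpha> * (2 * L)"
      using \<alpha> n by (intro mult_left_mono) (simp_all only: mult.assoc mult.commute[of 2])
    then show ?thesis
      using \<alpha> by (simp add: abs_mult mult.assoc)
  qed
  have "norm (dunkl_gradient Rp k u x) \<le> L + (\<Sum>\<alpha>\<in>Rp. k \<alpha> * (2 * L))" for x
    unfolding dunkl_gradient_eq
    by (rule norm_triangle_le) (use L quotient in \<open>auto intro!: add_mono sum_norm_le\<close>)
  moreover have "0 \<le> L + (\<Sum>\<alpha>\<in>Rp. k \<alpha> * (2 * L))"
    using L k_nonneg Rp_subset by (intro add_nonneg_nonneg sum_nonneg) auto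
  ultimately show thesis
    using that by blast
qed

lemma dunkl_gradient_outside:
  assumes zero: "\<And>x. r < norm x \<Longrightarrow> u x = 0" and "r < norm x"
  shows "dunkl_gradient Rp k u x = 0"
proof -
  have "open {y::real^'n. r < norm y}"
    by (intro open_Collect_less continuous_intros)
  then have "gradient u x = 0"
    using assms by (intro gradient_eq_0_if_locally_0[of "{y. r < norm y}"]) auto
  moreover have "u (reflection \<alpha> x) = 0" if "\<alpha> \<in> Rp" for \<alpha>
    using that assms Rp_subset root_nonzero by (auto intro!: zero simp: norm_reflection)
  ultimately show ?thesis
    using assms by (simp add: dunkl_gradient_eq)
qed

abbreviation v :: "real ^ 'n \<Rightarrow> real" where "v x \<equiv> u x / norm x"

lemma integrable_quotient_powr:
  assumes "0 \<le> p"
  shows "integrable \<mu> (\<lambda>x. \<bar>v x\<bar> powr p)"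
proof -
  obtain r where r: "\<And>x. r < norm x \<Longrightarrow> u x = 0"
    using support_annulus by metis
  obtain M where M: "0 \<le> M" "\<And>x. \<bar>v x\<bar> \<le> M"
    using quotient_by_norm_bounded by metis
  show ?thesis
  proof (rule integrable_bounded_support)
    show "\<bar>\<bar>v x\<bar> powr p\<bar> \<le> M powr p" for x
      using assms M(2)[of x] by (auto intro!: powr_mono2)
    show "\<bar>v x\<bar> powr p = 0" if "r < norm x" for x
      using r[OF that] by simp
  qed measurable
qed

text \<open>Euler's identity for \<open>|v| powr p\<close>.  The radial derivative of \<open>v = u / |x|\<close> is the quotient of the radial
derivative of \<open>u\<close> by \<open>|x|\<close>, minus \<open>v\<close>; this last term changes the factor \<open>- hom_dim\<close> into
\<open>p - hom_dim\<close>.\<close>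

lemma radial_derivative_integral:
  assumes p: "1 < p"
  shows "(LINT x|\<mu>. signed_powr (v x) (p - 1) * (x \<bullet> gradient u x / norm x))
           = (p - hom_dim) / p * (LINT x|\<mu>. \<bar>v x\<bar> powr p)"
proof -
  obtain r where r: "\<And>x. r < norm x \<Longrightarrow> u x = 0"
    using support_annulus by metis
  obtain L where L: "0 \<le> L" "\<And>x. norm (gradient u x) \<le> L"
    using bounded_gradient by metis
  obtain K where K: "0 \<le> K" "\<And>x y. \<bar>v x - v y\<bar> \<le> K * norm (x - y)"
    using quotient_by_norm_lipschitz by metis
  obtain M where M: "0 \<le> M" "\<And>x. \<bar>v x\<bar> \<le> M"
    using quotient_by_norm_bounded by metis
  define \<phi> where "\<phi> x = signed_powr (v x) (p - 1)" for x
  define D where "D x h = p * \<phi> x * ((gradient u x \<bullet> h) / norm x - u x * (x \<bullet> h) / norm x ^ 3)" for x h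
  have [measurable]: "\<phi> \<in> borel_measurable borel"
    unfolding \<phi>_def signed_powr_def by measurable
  have \<phi>_bound: "\<bar>\<phi> x\<bar> \<le> M powr (p - 1)" for x
    using p M(2)[of x] by (auto simp: \<phi>_def abs_signed_powr intro!: powr_mono2)
  have \<phi>v: "\<phi> x * v x = \<bar>v x\<bar> powr p" for x
    by (simp only: \<phi>_def signed_powr_mult_self)
  have euler: "(LINT x|\<mu>. D x x) = - hom_dim * (LINT x|\<mu>. \<bar>v x\<bar> powr p)"
  proof (rule euler_identity[where D = D and L = "p * M powr (p - 1) * K" and r = r])
    show "((\<lambda>x. \<bar>v x\<bar> powr p) has_derivative D x) (at x)" for x
      using has_derivative_compose[OF quotient_by_norm_has_derivative
          has_real_derivative_abs_powr[OF p, unfolded has_field_derivative_def]]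
      by (simp add: D_def[abs_def] \<phi>_def)
    show "\<bar>\<bar>v x\<bar> powr p - \<bar>v y\<bar> powr p\<bar> \<le> p * M powr (p - 1) * K * norm (x - y)" for x y
    proof -
      have "\<bar>\<bar>v x\<bar> powr p - \<bar>v y\<bar> powr p\<bar> \<le> p * M powr (p - 1) * \<bar>v x - v y\<bar>"
        using p M by (intro abs_powr_lipschitz) auto
      also have "\<dots> \<le> p * M powr (p - 1) * (K * norm (x - y))"
        using p K by (intro mult_left_mono) auto
      finally show ?thesis by (simp add: mult.assoc)
    qed
    show "\<bar>v x\<bar> powr p = 0" if "r < norm x" for x
      using that r by simp
  qed
  have D_eq: "D x x = p * (\<phi> x * (x \<bullet> gradient u x / norm x)) - p * \<bar>v x\<bar> powr p" for x
  proof -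
    have "u x * (x \<bullet> x) / norm x ^ 3 = v x"
      by (simp add: power3_eq_cube dot_square_norm power2_eq_square)
    then have "D x x = p * (\<phi> x * (x \<bullet> gradient u x / norm x)) - p * (\<phi> x * v x)"
      by (simp only: D_def inner_commute[of "gradient u x"]) (simp only: right_diff_distrib mult.assoc)
    then show ?thesis
      by (simp only: \<phi>v)
  qed
  have int1: "integrable \<mu> (\<lambda>x. \<phi> x * (x \<bullet> gradient u x / norm x))"
  proof (rule integrable_bounded_support)
    show "\<bar>\<phi> x * (x \<bullet> gradient u x / norm x)\<bar> \<le> M powr (p - 1) * L" for x
    proof -
      have "\<bar>x \<bullet> gradient u x\<bar> \<le> norm x * L"
        using Cauchy_Schwarz_ineq2[of x "gradient u x"] L(2)[of x]
        by (meson mult_left_mono norm_ge_zero order_trans)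
      then have "\<bar>x \<bullet> gradient u x / norm x\<bar> \<le> L"
        using L(1) by (cases "x = 0") (auto simp: divide_le_eq mult.commute)
      then show ?thesis
        unfolding abs_mult using \<phi>_bound[of x] by (intro mult_mono) auto
    qed
    show "\<phi> x * (x \<bullet> gradient u x / norm x) = 0" if "r < norm x" for x
      using r[OF that] by (simp add: \<phi>_def signed_powr_def)
  qed measurable
  have int2: "integrable \<mu> (\<lambda>x. \<bar>v x\<bar> powr p)"
    using p by (intro integrable_quotient_powr) simp
  have "p * (LINT x|\<mu>. \<phi> x * (x \<bullet> gradient u x / norm x)) - p * (LINT x|\<mu>. \<bar>v x\<bar> powr p)
      = - hom_dim * (LINT x|\<mu>. \<bar>v x\<bar> powr p)"
    using euler unfolding D_eq
    by (subst (asm) Bochner_Integration.integral_diff)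
       (use int1 int2 in \<open>auto simp only: integrable_mult_right integral_mult_right_zero\<close>)
  then show ?thesis
    using p unfolding \<phi>_def by (simp add: field_simps)
qed

text \<open>The sign comes from symmetrization: adding the integrand to its mirror image, which has the same integral, gives
a product of two increments of the same sign.\<close>

lemma reflection_term_nonneg:
  assumes p: "1 < p" and \<alpha>: "\<alpha> \<in> R"
  shows "0 \<le> (LINT x|\<mu>. signed_powr (v x) (p - 1) * (v x - v (reflection \<alpha> x)))"
    and "integrable \<mu> (\<lambda>x. signed_powr (v x) (p - 1) * (v x - v (reflection \<alpha> x)))"
proof -
  obtain r where r: "\<And>x. r < norm x \<Longrightarrow> u x = 0"
    using support_annulus by metis
  obtain M where M: "0 \<le> M" "\<And>x. \<bar>v x\<bar> \<le> M"
    using quotient_by_norm_bounded by metis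
  define \<phi> where "\<phi> x = signed_powr (v x) (p - 1)" for x
  define f where "f x = \<phi> x * (v x - v (reflection \<alpha> x))" for x
  have \<alpha>0: "\<alpha> \<noteq> 0" using \<alpha> by (rule root_nonzero)
  have [measurable]: "\<phi> \<in> borel_measurable borel"
    unfolding \<phi>_def signed_powr_def by measurable
  have [measurable]: "f \<in> borel_measurable borel"
    unfolding f_def by measurable
  have \<phi>_bound: "\<bar>\<phi> x\<bar> \<le> M powr (p - 1)" for x
    using p M(2)[of x] by (auto simp: \<phi>_def abs_signed_powr intro!: powr_mono2)
  have f_bound: "\<bar>f x\<bar> \<le> M powr (p - 1) * (2 * M)" for x
  proof -
    have "\<bar>v x - v (reflection \<alpha> x)\<bar> \<le> 2 * M"
      using M(2)[of x] M(2)[of "reflection \<alpha> x"] by linarith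
    then show ?thesis
      unfolding f_def abs_mult using \<phi>_bound[of x] by (intro mult_mono) auto
  qed
  have f_zero: "f x = 0" if "r < norm x" for x
    using r[OF that] by (simp add: f_def \<phi>_def signed_powr_def)
  have int_f: "integrable \<mu> f"
    by (rule integrable_bounded_support[OF _ f_bound f_zero]) measurable
  have int_fr: "integrable \<mu> (\<lambda>x. f (reflection \<alpha> x))"
    by (rule integrable_bounded_support[OF _ f_bound, where r = r])
       (use f_zero in \<open>auto simp: norm_reflection[OF \<alpha>0]\<close>)
  have "2 * (LINT x|\<mu>. f x) = (LINT x|\<mu>. f x + f (reflection \<alpha> x))"
    using int_f int_fr \<alpha> by (simp add: integral_reflection)
  also have "0 \<le> \<dots>"
  proof (rule Bochner_Integration.integral_nonneg)
    fix x
    have "f x + f (reflection \<alpha> x) = (\<phi> x - \<phi> (reflection \<alpha> x)) * (v x - v (reflection \<alpha> x))"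
    proof -
      have "a * (s - t) + b * (t - s) = (a - b) * (s - t)" for a b s t :: real
        by (simp add: algebra_simps)
      then show ?thesis
        unfolding f_def reflection_involution[OF \<alpha>0] .
    qed
    also have "\<dots> \<ge> 0"
      unfolding \<phi>_def using p by (intro signed_powr_monotone_product) simp
    finally show "0 \<le> f x + f (reflection \<alpha> x)" .
  qed
  finally have "0 \<le> (LINT x|\<mu>. f x)" by simp
  then show "0 \<le> (LINT x|\<mu>. signed_powr (v x) (p - 1) * (v x - v (reflection \<alpha> x)))"
    "integrable \<mu> (\<lambda>x. signed_powr (v x) (p - 1) * (v x - v (reflection \<alpha> x)))"
    using int_f unfolding f_def \<phi>_def .
qed

text \<open>With \<open>A\<close> the integral of \<open>|v| powr p\<close> and \<open>W = |\<nabla>\<^sub>k u|\<close>, Euler's identity and the sign of the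
reflection terms give \<open>c A \<le> \<integral> |v| powr (p - 1) W d\<mu>\<close>.  Multiplied by \<open>c powr (p - 1)\<close>, Young's
inequality bounds the right-hand side by \<open>(p - 1) / p\<close> times \<open>c powr p A\<close>, the term on the left, plus the
wanted integral divided by \<open>p\<close>.\<close>

theorem hardy_inequality:
  assumes p: "1 < p" "hom_dim < p"
  shows "dunkl_hardy_inequality Rp k p (((p - hom_dim) / p) powr p) u"
proof -
  obtain r where r: "\<And>x. r < norm x \<Longrightarrow> u x = 0"
    using support_annulus by metis
  obtain M where M: "0 \<le> M" "\<And>x. \<bar>v x\<bar> \<le> M"
    using quotient_by_norm_bounded by metis
  obtain B where B: "0 \<le> B" "\<And>x. norm (dunkl_gradient Rp k u x) \<le> B"
    using dunkl_gradient_bounded by metis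
  define c where "c = (p - hom_dim) / p"
  have c: "0 < c" using p by (simp add: c_def)
  define W where "W x = norm (dunkl_gradient Rp k u x)" for x
  have [measurable]: "W \<in> borel_measurable borel"
    unfolding W_def by measurable
  define \<phi> where "\<phi> x = signed_powr (v x) (p - 1)" for x
  have [measurable]: "\<phi> \<in> borel_measurable borel"
    unfolding \<phi>_def signed_powr_def by measurable
  define A where "A = (LINT x|\<mu>. \<bar>v x\<bar> powr p)"
  define G where "G x = \<phi> x * (x \<bullet> dunkl_gradient Rp k u x / norm x)" for x
  have W_zero: "W x = 0" if "r < norm x" for x
    using dunkl_gradient_outside[OF r that] by (simp add: W_def)
  have intA: "integrable \<mu> (\<lambda>x. \<bar>v x\<bar> powr p)"
    using p by (intro integrable_quotient_powr) simp
  have intW: "integrable \<mu> (\<lambda>x. W x powr p)"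
  proof (rule integrable_bounded_support)
    show "\<bar>W x powr p\<bar> \<le> B powr p" for x
      using p B(2)[of x] by (auto simp: W_def intro!: powr_mono2)
    show "W x powr p = 0" if "r < norm x" for x
      using W_zero[OF that] by simp
  qed measurable
  have G_le: "\<bar>G x\<bar> \<le> \<bar>v x\<bar> powr (p - 1) * W x" for x
  proof -
    have "\<bar>x \<bullet> dunkl_gradient Rp k u x / norm x\<bar> \<le> W x"
      using Cauchy_Schwarz_ineq2[of x "dunkl_gradient Rp k u x"]
      by (cases "x = 0") (auto simp: W_def divide_le_eq mult.commute)
    then have "\<bar>v x\<bar> powr (p - 1) * \<bar>x \<bullet> dunkl_gradient Rp k u x / norm x\<bar> \<le> \<bar>v x\<bar> powr (p - 1) * W x"
      by (rule mult_left_mono) simp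
    then show ?thesis
      using p unfolding G_def \<phi>_def abs_mult by (subst abs_signed_powr) auto
  qed
  have intG: "integrable \<mu> G"
  proof (rule integrable_bounded_support)
    show "\<bar>G x\<bar> \<le> M powr (p - 1) * B" for x
    proof -
      have "\<bar>v x\<bar> powr (p - 1) * W x \<le> M powr (p - 1) * B"
        using p M(2)[of x] B by (intro mult_mono powr_mono2) (auto simp: W_def)
      then show ?thesis using G_le[of x] by linarith
    qed
    show "G x = 0" if "r < norm x" for x
      using r[OF that] by (simp add: G_def \<phi>_def signed_powr_def)
    show "G \<in> borel_measurable borel"
      unfolding G_def by measurable
  qed
  have refl: "0 \<le> (LINT x|\<mu>. \<phi> x * (v x - v (reflection \<alpha> x)))"
    "integrable \<mu> (\<lambda>x. \<phi> x * (v x - v (reflection \<alpha> x)))" if "\<alpha> \<in> Rp" for \<alpha>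
    using reflection_term_nonneg[OF p(1), of \<alpha>] that Rp_subset unfolding \<phi>_def by auto
  \<comment> \<open>Reflections preserve the norm, so the division by \<open>|x|\<close> turns differences of \<open>u\<close> into differences of \<open>v\<close>.\<close>
  have split: "\<phi> x * (x \<bullet> gradient u x / norm x)
      = G x - (\<Sum>\<alpha>\<in>Rp. k \<alpha> * (\<phi> x * (v x - v (reflection \<alpha> x))))" for x
  proof -
    have "(\<Sum>\<alpha>\<in>Rp. k \<alpha> * (\<phi> x * (v x - v (reflection \<alpha> x))))
        = \<phi> x * ((\<Sum>\<alpha>\<in>Rp. k \<alpha> * (u x - u (reflection \<alpha> x))) / norm x)"
      unfolding sum_divide_distrib sum_distrib_left
      using Rp_subset root_nonzero
      by (intro sum.cong) (auto simp: norm_reflection subset_iff diff_divide_distrib[symmetric] mult.left_commute)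
    then show ?thesis
      by (simp add: G_def inner_dunkl_gradient add_divide_distrib distrib_left)
  qed
  have "c * A = (LINT x|\<mu>. \<phi> x * (x \<bullet> gradient u x / norm x))"
    using radial_derivative_integral[OF p(1)] by (simp add: c_def A_def \<phi>_def)
  also have "\<dots> = (LINT x|\<mu>. G x) - (\<Sum>\<alpha>\<in>Rp. k \<alpha> * (LINT x|\<mu>. \<phi> x * (v x - v (reflection \<alpha> x))))"
    unfolding split using intG refl(2)
    by (subst Bochner_Integration.integral_diff) (auto simp: Bochner_Integration.integral_sum)
  also have "\<dots> \<le> (LINT x|\<mu>. G x)"
    using refl(1) k_nonneg Rp_subset by (auto intro!: sum_nonneg)
  finally have cA: "c * A \<le> (LINT x|\<mu>. G x)" .
  have "c powr p * A = c powr (p - 1) * (c * A)"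
    using c by (simp add: powr_diff)
  also have "\<dots> \<le> c powr (p - 1) * (LINT x|\<mu>. G x)"
    using cA by (intro mult_left_mono) auto
  also have "\<dots> = (LINT x|\<mu>. c powr (p - 1) * G x)"
    by simp
  also have "\<dots> \<le> (LINT x|\<mu>. (p - 1) / p * (c powr p * \<bar>v x\<bar> powr p) + W x powr p / p)"
  proof (rule integral_mono)
    fix x
    have "c powr (p - 1) * G x \<le> c powr (p - 1) * (\<bar>v x\<bar> powr (p - 1) * W x)"
      using G_le[of x] by (intro mult_left_mono) auto
    also have "\<dots> = (c * \<bar>v x\<bar>) powr (p - 1) * W x"
      by (simp only: powr_mult mult.assoc)
    also have "\<dots> \<le> (p - 1) / p * (c * \<bar>v x\<bar>) powr p + W x powr p / p"
      using p c by (intro Young_powr) (auto simp: W_def)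
    finally show "c powr (p - 1) * G x \<le> (p - 1) / p * (c powr p * \<bar>v x\<bar> powr p) + W x powr p / p"
      by (simp only: powr_mult)
  qed (use intA intW intG in auto)
  also have "\<dots> = (p - 1) / p * (c powr p * A) + (LINT x|\<mu>. W x powr p) / p"
    using intA intW by (simp add: A_def)
  finally have "c powr p * A \<le> (LINT x|\<mu>. W x powr p)"
    using p by (simp add: field_simps)
  moreover have "A = (LINT x|\<mu>. \<bar>u x\<bar> powr p / norm x powr p)"
    unfolding A_def by (simp add: powr_divide)
  ultimately show ?thesis
    by (simp add: dunkl_hardy_inequality_def c_def W_def)
qed

end

section \<open>Smoothness through iterated partial derivatives\<close>

abbreviation "tcd \<equiv> times_continuously_differentiable"

text \<open>Closure properties of the class are proved by induction on the order; this rule exposes the partial derivatives as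
explicit expressions, to which the induction hypothesis applies.\<close>

lemma tcd_SucI:
  fixes u :: "real ^ 'n \<Rightarrow> real"
  assumes der: "\<And>x. (u has_derivative D x) (at x)"
    and "\<And>i. tcd m (\<lambda>x. D x (axis i 1))"
  shows "tcd (Suc m) u"
proof -
  have "partial_derivative i u = (\<lambda>x. D x (axis i 1))" for i
    unfolding partial_derivative_def using frechet_derivative_at[OF der] by (metis (no_types, lifting))
  moreover have "u differentiable (at x)" for x
    using der by (auto simp: differentiable_def)
  ultimately show ?thesis
    using assms(2) by simp
qed

lemma tcd_has_derivative:
  fixes u :: "real ^ 'n \<Rightarrow> real"
  assumes "tcd (Suc m) u"
  shows "(u has_derivative frechet_derivative u (at x)) (at x)"
  using assms by (simp flip: frechet_derivative_works)

lemma tcd_partial_derivative: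
  fixes u :: "real ^ 'n \<Rightarrow> real"
  assumes "tcd (Suc m) u"
  shows "tcd m (\<lambda>x. frechet_derivative u (at x) (axis i 1))"
proof -
  have "partial_derivative i u = (\<lambda>x. frechet_derivative u (at x) (axis i 1))"
    by (simp add: partial_derivative_def fun_eq_iff)
  then show ?thesis
    using assms by (metis times_continuously_differentiable.simps(2))
qed

lemma tcd_SucD: "tcd (Suc m) u \<Longrightarrow> tcd m u"
proof (induction m arbitrary: u)
  case 0
  then show ?case
    by (auto intro!: differentiable_imp_continuous_on
        simp: differentiable_on_def intro: differentiable_at_withinI)
qed auto

lemma tcd_const: "tcd m (\<lambda>x. c)"
proof (induction m arbitrary: c)
  case (Suc m)
  show ?case
    by (rule tcd_SucI[where D = "\<lambda>x h. 0"]) (use Suc in auto)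
qed simp

lemma tcd_add: "tcd m u \<Longrightarrow> tcd m v \<Longrightarrow> tcd m (\<lambda>x. u x + v x)"
proof (induction m arbitrary: u v)
  case (Suc m)
  show ?case
    by (rule tcd_SucI[OF has_derivative_add[OF Suc.prems[THEN tcd_has_derivative]]])
       (intro Suc.IH Suc.prems[THEN tcd_partial_derivative])
qed (simp add: continuous_on_add)

lemma tcd_mult: "tcd m u \<Longrightarrow> tcd m v \<Longrightarrow> tcd m (\<lambda>x. u x * v x)"
proof (induction m arbitrary: u v)
  case (Suc m)
  show ?case
    by (rule tcd_SucI[OF has_derivative_mult[OF Suc.prems[THEN tcd_has_derivative]]])
       (intro tcd_add Suc.IH Suc.prems[THEN tcd_partial_derivative] Suc.prems[THEN tcd_SucD])
qed (simp add: continuous_on_mult)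

lemma tcd_diff: "tcd m u \<Longrightarrow> tcd m v \<Longrightarrow> tcd m (\<lambda>x. u x - v x)"
  using tcd_add[OF _ tcd_mult[OF tcd_const, of m v "-1"], of u] by simp

lemma tcd_component: "tcd m (\<lambda>x. x $ i)"
proof (cases m)
  case (Suc m')
  show ?thesis
    unfolding Suc
    by (rule tcd_SucI[where D = "\<lambda>x h. h $ i"])
       (auto intro: tcd_const bounded_linear_imp_has_derivative bounded_linear_vec_nth)
qed (simp add: continuous_on_component)

lemma tcd_sum: "(\<And>i. i \<in> I \<Longrightarrow> tcd m (f i)) \<Longrightarrow> tcd m (\<lambda>x. \<Sum>i\<in>I. f i x)"
  by (induction I rule: infinite_finite_induct) (auto intro: tcd_const tcd_add)

lemma tcd_norm_square: "tcd m (\<lambda>x. x \<bullet> x)"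
  unfolding inner_vec_def inner_real_def by (intro tcd_sum tcd_mult tcd_component)

text \<open>The exponent has to vary in the induction, because differentiation lowers it.\<close>

lemma tcd_powr:
  assumes "tcd m v" "\<And>x. 0 < v x"
  shows "tcd m (\<lambda>x. v x powr q)"
  using assms(1)
proof (induction m arbitrary: q)
  case 0
  then show ?case
    using assms(2) by (auto intro!: continuous_on_powr simp: less_imp_neq[symmetric])
next
  case (Suc m)
  show ?case
  proof (rule tcd_SucI)
    show "((\<lambda>x. v x powr q) has_derivative
        (\<lambda>h. (q * v x powr (q - 1)) * frechet_derivative v (at x) h)) (at x)" for x
      using has_derivative_compose[OF tcd_has_derivative[OF Suc.prems]
          has_real_derivative_powr[OF assms(2), unfolded has_field_derivative_def]] .
    show "tcd m (\<lambda>x. (q * v x powr (q - 1)) * frechet_derivative v (at x) (axis i 1))" for i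
      by (intro tcd_mult tcd_const Suc.IH tcd_partial_derivative[OF Suc.prems] tcd_SucD[OF Suc.prems])
  qed
qed

section \<open>Smooth cutoffs\<close>

text \<open>For \<open>q = 0\<close> this is the standard smooth function that is flat at the origin.  The additional power makes the
family closed under differentiation up to linear combinations, so that smoothness follows for all members at
once, without closed formulas for higher derivatives.\<close>

definition flat_exp :: "real \<Rightarrow> real \<Rightarrow> real" where
  "flat_exp q t = (if 0 < t then t powr q * exp (- 1 / t) else 0)"

lemma flat_exp_has_derivative:
  "(flat_exp q has_real_derivative flat_exp (q - 2) t + q * flat_exp (q - 1) t) (at t)"
proof -
  consider "0 < t" | "t < 0" | "t = 0" by linarith
  then show ?thesis
  proof cases
    case 1
    have "((\<lambda>t. t powr q * exp (- 1 / t)) has_real_derivative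
        t powr q * (exp (- 1 / t) * (1 / t\<^sup>2)) + q * t powr (q - 1) * exp (- 1 / t)) (at t)"
      using 1 by (auto intro!: derivative_eq_intros simp: power2_eq_square)
    moreover have "t powr q * (exp (- 1 / t) * (1 / t\<^sup>2)) + q * t powr (q - 1) * exp (- 1 / t)
        = flat_exp (q - 2) t + q * flat_exp (q - 1) t"
      using 1 by (simp add: flat_exp_def powr_diff)
    ultimately have "((\<lambda>t. t powr q * exp (- 1 / t)) has_real_derivative
        flat_exp (q - 2) t + q * flat_exp (q - 1) t) (at t)"
      by simp
    then show ?thesis
      by (rule has_field_derivative_transform_within_open[of _ _ _ "{0<..}"])
         (use 1 in \<open>auto simp: flat_exp_def\<close>)
  next
    case 2
    have "((\<lambda>t. 0) has_real_derivative flat_exp (q - 2) t + q * flat_exp (q - 1) t) (at t)"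
      using 2 by (simp add: flat_exp_def)
    then show ?thesis
      by (rule has_field_derivative_transform_within_open[of _ _ _ "{..<0}"])
         (use 2 in \<open>auto simp: flat_exp_def\<close>)
  next
    case 3
    \<comment> \<open>The exponential decay beats every negative power, which covers arbitrary real \<open>q\<close>.\<close>
    have "((\<lambda>h. h powr q * exp (- 1 / h) / h) \<longlongrightarrow> 0) (at_right 0)"
      by real_asymp
    then have "((\<lambda>h. flat_exp q h / h) \<longlongrightarrow> 0) (at_right 0)"
      by (rule Lim_transform_eventually) (auto simp: eventually_at_filter flat_exp_def)
    moreover have "((\<lambda>h. flat_exp q h / h) \<longlongrightarrow> 0) (at_left 0)"
      by (rule Lim_transform_eventually[OF tendsto_const]) (auto simp: eventually_at_filter flat_exp_def)
    ultimately have "((\<lambda>h. flat_exp q h / h) \<longlongrightarrow> 0) (at 0)"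
      by (simp add: filterlim_split_at)
    then show ?thesis
      using 3 by (simp add: DERIV_def flat_exp_def)
  qed
qed

lemma continuous_flat_exp: "continuous_on A (flat_exp q)"
  by (rule DERIV_continuous_on[OF has_field_derivative_at_within[OF flat_exp_has_derivative]])

lemma tcd_flat_exp:
  assumes "tcd m v"
  shows "tcd m (\<lambda>x. flat_exp q (v x))"
  using assms
proof (induction m arbitrary: q)
  case 0
  then show ?case
    by (auto intro: continuous_on_compose2[OF continuous_flat_exp[of UNIV]])
next
  case (Suc m)
  show ?case
  proof (rule tcd_SucI)
    show "((\<lambda>x. flat_exp q (v x)) has_derivative
        (\<lambda>h. (flat_exp (q - 2) (v x) + q * flat_exp (q - 1) (v x)) * frechet_derivative v (at x) h)) (at x)" for x
      using has_derivative_compose[OF tcd_has_derivative[OF Suc.prems]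
          flat_exp_has_derivative[unfolded has_field_derivative_def]] .
    show "tcd m (\<lambda>x. (flat_exp (q - 2) (v x) + q * flat_exp (q - 1) (v x)) * frechet_derivative v (at x) (axis i 1))" for i
      by (intro tcd_mult tcd_add tcd_const Suc.IH tcd_partial_derivative[OF Suc.prems] tcd_SucD[OF Suc.prems])
  qed
qed

text \<open>The inner argument \<open>exp (- 1) - flat_exp 0 (1 - s)\<close> is at most zero for \<open>s \<le> 0\<close> and constant for
\<open>s \<ge> 1\<close>.  The step therefore needs no division; its height \<open>smooth_step 1\<close> is some number in
\<open>(0, 1]\<close>.\<close>

definition smooth_step :: "real \<Rightarrow> real" where
  "smooth_step s = flat_exp 0 (exp (- 1) - flat_exp 0 (1 - s))"

definition smooth_step' :: "real \<Rightarrow> real" where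
  "smooth_step' s = flat_exp (- 2) (exp (- 1) - flat_exp 0 (1 - s)) * flat_exp (- 2) (1 - s)"

lemma smooth_step_has_derivative: "(smooth_step has_real_derivative smooth_step' s) (at s)"
proof -
  have d: "(flat_exp 0 has_real_derivative flat_exp (- 2) t) (at t)" for t
    using flat_exp_has_derivative[of 0 t] by simp
  have "((\<lambda>s. flat_exp 0 (1 - s)) has_real_derivative flat_exp (- 2) (1 - s) * (0 - 1)) (at s)"
    by (intro DERIV_chain2[OF d] DERIV_diff DERIV_const DERIV_ident)
  then have "((\<lambda>s. exp (- 1) - flat_exp 0 (1 - s)) has_real_derivative flat_exp (- 2) (1 - s)) (at s)"
    using DERIV_diff[OF DERIV_const[of "exp (- 1)"]] by fastforce
  from DERIV_chain2[OF d this] show ?thesis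
    by (simp add: smooth_step_def[abs_def] smooth_step'_def)
qed

lemma flat_exp_0_ge: "1 \<le> t \<Longrightarrow> exp (- 1) \<le> flat_exp 0 t"
  by (simp add: flat_exp_def)

lemma smooth_step_left: "s \<le> 0 \<Longrightarrow> smooth_step s = 0" "s \<le> 0 \<Longrightarrow> smooth_step' s = 0"
  using flat_exp_0_ge[of "1 - s"] by (simp_all add: smooth_step_def smooth_step'_def flat_exp_def[of _ "_ - _"])

lemma smooth_step_right: "1 \<le> s \<Longrightarrow> smooth_step s = smooth_step 1" "1 \<le> s \<Longrightarrow> smooth_step' s = 0"
  by (simp_all add: smooth_step_def smooth_step'_def flat_exp_def)

lemma smooth_step_bounds: "0 \<le> smooth_step s" "smooth_step s \<le> 1"
  by (auto simp: smooth_step_def flat_exp_def)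

lemma smooth_step_1_pos: "0 < smooth_step 1"
  by (simp add: smooth_step_def flat_exp_def)

lemma smooth_step'_bounded:
  obtains B where "0 \<le> B" "\<And>s. \<bar>smooth_step' s\<bar> \<le> B"
proof -
  have "continuous_on {0..1} smooth_step'"
    unfolding smooth_step'_def[abs_def]
    by (intro continuous_intros continuous_on_compose2[OF continuous_flat_exp[of UNIV]]) auto
  then have "compact (smooth_step' ` {0..1})"
    by (rule compact_continuous_image) simp
  then obtain B where B: "\<And>s. s \<in> {0..1} \<Longrightarrow> \<bar>smooth_step' s\<bar> \<le> B"
    by (fastforce dest: compact_imp_bounded simp: bounded_iff)
  have "\<bar>smooth_step' s\<bar> \<le> max 0 B" for s
    using B[of s] smooth_step_left(2)[of s] smooth_step_right(2)[of s]
    by (cases "s \<le> 0"; cases "1 \<le> s") auto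
  then show thesis
    using that[of "max 0 B"] by simp
qed

lemma tcd_smooth_step:
  assumes "tcd m v"
  shows "tcd m (\<lambda>x. smooth_step (v x))"
  unfolding smooth_step_def by (intro tcd_flat_exp tcd_diff tcd_const assms)

section \<open>Almost extremal radial functions\<close>

text \<open>As a function of \<open>t = |x|\<^sup>2\<close>.  The cutoffs are constant on \<open>2 \<le> t \<le> a\<close> and vanish outside
\<open>1 \<le> t \<le> 2 a\<close>.  The shift by 1 in the power keeps the function smooth at the origin.\<close>

definition profile :: "real \<Rightarrow> real \<Rightarrow> real \<Rightarrow> real" where
  "profile c a t = (1 + t) powr (c / 2) * (smooth_step (t - 1) * smooth_step (2 - t / a))"

definition profile' :: "real \<Rightarrow> real \<Rightarrow> real \<Rightarrow> real" where
  "profile' c a t =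
     (1 + t) powr (c / 2) *
       (smooth_step' (t - 1) * smooth_step (2 - t / a) - smooth_step (t - 1) * smooth_step' (2 - t / a) / a)
     + c / 2 * (1 + t) powr (c / 2 - 1) * (smooth_step (t - 1) * smooth_step (2 - t / a))"

text \<open>Radial test functions that, as \<open>a\<close> tends to infinity, approach equality in the Hardy inequality.\<close>

definition extremal :: "real \<Rightarrow> real \<Rightarrow> real ^ 'n \<Rightarrow> real" where
  "extremal c a x = profile c a (x \<bullet> x)"

lemma profile_has_derivative:
  assumes "0 \<le> t" "0 < a"
  shows "(profile c a has_real_derivative profile' c a t) (at t)"
proof -
  have "((\<lambda>t. t - 1) has_real_derivative 1) (at t)"
    by (auto intro!: derivative_eq_intros)
  from DERIV_chain2[OF smooth_step_has_derivative this]
  have 1: "((\<lambda>t. smooth_step (t - 1)) has_real_derivative smooth_step' (t - 1)) (at t)"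
    by simp
  have "((\<lambda>t. 2 - t / a) has_real_derivative - 1 / a) (at t)"
    using assms by (auto intro!: derivative_eq_intros)
  from DERIV_chain2[OF smooth_step_has_derivative this]
  have 2: "((\<lambda>t. smooth_step (2 - t / a)) has_real_derivative - (smooth_step' (2 - t / a) / a)) (at t)"
    by simp
  have pos: "0 < 1 + t"
    using assms by simp
  have "((\<lambda>t. 1 + t) has_real_derivative 1) (at t)"
    by (auto intro!: derivative_eq_intros)
  from DERIV_chain2[where g = "\<lambda>t. 1 + t", OF has_real_derivative_powr[OF pos, of "c / 2"] this]
  have 3: "((\<lambda>t. (1 + t) powr (c / 2)) has_real_derivative c / 2 * (1 + t) powr (c / 2 - 1)) (at t)"
    by (simp only: mult_1_right)
  from DERIV_mult[OF 3 DERIV_mult[OF 1 2]] show ?thesis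
    by (simp add: profile_def[abs_def] profile'_def algebra_simps)
qed

lemma gradient_extremal:
  assumes "0 < a"
  shows "gradient (extremal c a) x = (2 * profile' c a (x \<bullet> x)) *\<^sub>R x"
proof (rule gradient_eqI)
  have "((\<lambda>x. x \<bullet> x) has_derivative (\<lambda>h. 2 * (x \<bullet> h))) (at x)"
    by (auto intro!: derivative_eq_intros simp: inner_commute)
  from has_derivative_compose[OF this
      profile_has_derivative[OF inner_ge_zero assms, unfolded has_field_derivative_def]]
  show "(extremal c a has_derivative (\<lambda>h. (2 * profile' c a (x \<bullet> x)) *\<^sub>R x \<bullet> h)) (at x)"
    by (simp add: extremal_def[abs_def] mult_ac)
qed

lemma smooth_extremal: "smooth (extremal c a)"
proof -
  have eq: "extremal c a = (\<lambda>x. (1 + x \<bullet> x) powr (c / 2) *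
      (smooth_step (x \<bullet> x - 1) * smooth_step (2 - x \<bullet> x * inverse a)))"
    by (simp add: extremal_def[abs_def] profile_def divide_inverse[of _ a])
  show ?thesis
    unfolding smooth_def eq
    by (intro allI tcd_mult tcd_powr tcd_smooth_step tcd_diff tcd_add tcd_const tcd_norm_square)
       (simp add: add_pos_nonneg)
qed

lemma extremal_test_function:
  assumes a: "0 < a"
  shows "(extremal c a :: real ^ 'n \<Rightarrow> real) \<in> test_functions_off_origin"
proof -
  define S :: "(real ^ 'n) set" where "S = {x. 1 \<le> x \<bullet> x} \<inter> {x. x \<bullet> x \<le> 2 * a}"
  have "extremal c a x = 0" if "x \<notin> S" for x :: "real ^ 'n"
  proof (cases "1 \<le> x \<bullet> x")
    case True
    then have "2 - x \<bullet> x / a \<le> 0"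
      using that a by (simp add: S_def field_simps)
    then show ?thesis
      by (simp add: extremal_def profile_def smooth_step_left)
  qed (simp add: extremal_def profile_def smooth_step_left)
  then have sub: "{x :: real ^ 'n. extremal c a x \<noteq> 0} \<subseteq> S"
    by blast
  have "closed S"
    unfolding S_def by (intro closed_Int closed_Collect_le continuous_intros)
  moreover have "bounded S"
    unfolding bounded_iff S_def
    by (rule exI[of _ "sqrt (2 * a)"]) (auto simp: norm_eq_sqrt_inner)
  ultimately have "compact S"
    by (simp add: compact_eq_bounded_closed)
  moreover have clos: "closure {x :: real ^ 'n. extremal c a x \<noteq> 0} \<subseteq> S"
    using sub \<open>closed S\<close> by (rule closure_minimal)
  ultimately have "compact (closure {x :: real ^ 'n. extremal c a x \<noteq> 0})"
    by (metis closed_closure compact_Int_closed inf.absorb2)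
  moreover have "0 \<notin> S" by (simp add: S_def)
  ultimately show ?thesis
    using smooth_extremal[of c a] clos by (auto simp: test_functions_off_origin_def)
qed

lemma profile_nonneg: "0 \<le> profile c a t"
  by (simp add: profile_def smooth_step_bounds)

lemma profile_plateau:
  assumes "2 \<le> t" "0 < a" "t \<le> a"
  shows "profile c a t = (smooth_step 1)\<^sup>2 * (1 + t) powr (c / 2)"
    and "profile' c a t = c / 2 * profile c a t / (1 + t)"
proof -
  have "t / a \<le> 1"
    using assms by simp
  then have *: "1 \<le> 2 - t / a" "1 \<le> t - 1"
    using assms by simp_all
  show "profile c a t = (smooth_step 1)\<^sup>2 * (1 + t) powr (c / 2)"
    using * by (simp add: profile_def smooth_step_right(1)[of "t - 1"] smooth_step_right(1)[of "2 - t / a"] power2_eq_square)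
  show "profile' c a t = c / 2 * profile c a t / (1 + t)"
    using assms by (simp add: profile'_def profile_def smooth_step_right(2)[OF *(1)] smooth_step_right(2)[OF *(2)] powr_diff)
qed

text \<open>Uniform in \<open>a\<close>, since the upper cutoff is constant here.\<close>

lemma profile'_lower_transition:
  assumes "0 < c" "c < 1" "2 \<le> a" "0 \<le> t" "t \<le> 2" and D: "\<And>s. \<bar>smooth_step' s\<bar> \<le> D"
  shows "\<bar>profile' c a t\<bar> \<le> 3 * D + 1"
proof -
  have "1 \<le> 2 - t / a"
    using assms by (simp add: divide_le_eq)
  then have "profile' c a t = (1 + t) powr (c / 2) * (smooth_step' (t - 1) * smooth_step (2 - t / a))
      + c / 2 * (1 + t) powr (c / 2 - 1) * (smooth_step (t - 1) * smooth_step (2 - t / a))"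
    by (simp add: profile'_def smooth_step_right(2))
  also have "\<bar>\<dots>\<bar> \<le> 3 * (D * 1) + 1 * 1 * (1 * 1)"
  proof (rule order_trans[OF abs_triangle_ineq], rule add_mono)
    have "(1 + t) powr (c / 2) \<le> (1 + t) powr 1"
      using assms by (intro powr_mono) auto
    then have "(1 + t) powr (c / 2) \<le> 3"
      using assms by simp
    then show "\<bar>(1 + t) powr (c / 2) * (smooth_step' (t - 1) * smooth_step (2 - t / a))\<bar> \<le> 3 * (D * 1)"
      unfolding abs_mult using D smooth_step_bounds
      by (intro mult_mono) (auto intro: order_trans[OF abs_ge_zero])
    have "(1 + t) powr (c / 2 - 1) \<le> (1 + t) powr 0"
      using assms by (intro powr_mono) auto
    then show "\<bar>c / 2 * (1 + t) powr (c / 2 - 1) * (smooth_step (t - 1) * smooth_step (2 - t / a))\<bar> \<le> 1 * 1 * (1 * 1)"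
      unfolding abs_mult using assms smooth_step_bounds
      by (intro mult_mono) auto
  qed
  finally show ?thesis by simp
qed

text \<open>Each differentiation of the cutoff costs a factor of order \<open>1 / a\<close>, as does each differentiation of the power,
so the gradient is of the order expected from scaling.\<close>

lemma profile'_upper_transition:
  assumes "0 < c" "c < 1" "2 \<le> a" "a \<le> t" "t \<le> 2 * a" and D: "\<And>s. \<bar>smooth_step' s\<bar> \<le> D"
  shows "2 * \<bar>profile' c a t\<bar> * sqrt t \<le> (12 * D + 1) * a powr ((c - 1) / 2)"
proof -
  have t: "0 < t" "0 < a" "1 \<le> t - 1" using assms by auto
  have D0: "0 \<le> D" using D[of 0] by linarith
  have "profile' c a t = (1 + t) powr (c / 2) * - (smooth_step (t - 1) * smooth_step' (2 - t / a) / a)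
      + c / 2 * (1 + t) powr (c / 2 - 1) * (smooth_step (t - 1) * smooth_step (2 - t / a))"
    using t(3) by (simp add: profile'_def smooth_step_right(2))
  also have "\<bar>\<dots>\<bar> \<le> (1 + t) powr (c / 2) * (1 * D / a) + 1 / 2 * (1 + t) powr (c / 2 - 1) * (1 * 1)"
  proof (rule order_trans[OF abs_triangle_ineq], rule add_mono)
    show "\<bar>(1 + t) powr (c / 2) * - (smooth_step (t - 1) * smooth_step' (2 - t / a) / a)\<bar>
        \<le> (1 + t) powr (c / 2) * (1 * D / a)"
      unfolding abs_mult abs_minus_cancel abs_divide using D D0 t smooth_step_bounds
      by (intro mult_mono divide_mono) auto
    show "\<bar>c / 2 * (1 + t) powr (c / 2 - 1) * (smooth_step (t - 1) * smooth_step (2 - t / a))\<bar>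
        \<le> 1 / 2 * (1 + t) powr (c / 2 - 1) * (1 * 1)"
      unfolding abs_mult using assms smooth_step_bounds by (intro mult_mono) auto
  qed
  finally have "2 * \<bar>profile' c a t\<bar> * sqrt t
      \<le> (2 * ((1 + t) powr (c / 2) * (D / a)) + (1 + t) powr (c / 2 - 1)) * sqrt t"
    using t by (intro mult_right_mono) auto
  also have "\<dots> \<le> (2 * ((1 + t) powr (c / 2) * (D / a)) + (1 + t) powr (c / 2 - 1)) * (1 + t) powr (1 / 2)"
    using t D0 by (intro mult_left_mono) (auto simp: powr_half_sqrt)
  also have "\<dots> = 2 * D / a * (1 + t) powr ((c + 1) / 2) + (1 + t) powr ((c - 1) / 2)"
  proof -
    have "(1 + t) powr (c / 2) * (1 + t) powr (1 / 2) = (1 + t) powr ((c + 1) / 2)"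
      by (simp add: powr_add[symmetric] add_divide_distrib)
    moreover have "(1 + t) powr (c / 2 - 1) * (1 + t) powr (1 / 2) = (1 + t) powr ((c - 1) / 2)"
      by (simp add: powr_add[symmetric] diff_divide_distrib)
    ultimately show ?thesis
      by (simp add: algebra_simps)
  qed
  also have "\<dots> \<le> 2 * D / a * (6 * a powr ((c + 1) / 2)) + a powr ((c - 1) / 2)"
  proof (intro add_mono mult_left_mono)
    have "(1 + t) powr ((c + 1) / 2) \<le> (3 * a) powr ((c + 1) / 2)"
      using assms by (intro powr_mono2) auto
    also have "\<dots> = 3 powr ((c + 1) / 2) * a powr ((c + 1) / 2)"
      by (simp add: powr_mult)
    also have "\<dots> \<le> 3 powr 1 * a powr ((c + 1) / 2)"
      using assms by (intro mult_right_mono powr_mono) auto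
    also have "\<dots> \<le> 6 * a powr ((c + 1) / 2)" by simp
    finally show "(1 + t) powr ((c + 1) / 2) \<le> 6 * a powr ((c + 1) / 2)" .
    show "(1 + t) powr ((c - 1) / 2) \<le> a powr ((c - 1) / 2)"
      using assms by (intro powr_mono2') auto
  qed (use D0 t in auto)
  also have "a powr ((c + 1) / 2) = a powr ((c - 1) / 2) * a"
  proof -
    have "a powr ((c - 1) / 2) * a = a powr ((c - 1) / 2) * a powr 1"
      using t by simp
    also have "\<dots> = a powr ((c + 1) / 2)"
      unfolding powr_add[symmetric] by (simp add: field_simps)
    finally show ?thesis by simp
  qed
  finally show ?thesis
    using t by (simp add: algebra_simps)
qed

lemma extremal_zero:
  assumes "0 < a" "x \<bullet> x \<le> 1 \<or> 2 * a \<le> x \<bullet> x"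
  shows "profile' c a (x \<bullet> x) = 0"
proof (cases "x \<bullet> x \<le> 1")
  case True
  then show ?thesis by (simp add: profile'_def smooth_step_left)
next
  case False
  then have "2 - x \<bullet> x / a \<le> 0"
    using assms by (simp add: field_simps)
  then show ?thesis by (simp add: profile'_def smooth_step_left)
qed

text \<open>On the plateau of the cutoffs the first term alone suffices, because
\<open>2 r (c / 2) (1 + r\<^sup>2) powr (c / 2 - 1) \<le> (c / r) (1 + r\<^sup>2) powr (c / 2)\<close>.  The two indicator terms account for the
transition regions.\<close>

lemma extremal_gradient_bound:
  fixes x :: "real ^ 'n"
  assumes c: "0 < c" "c < 1" and p: "0 < p" and a: "2 \<le> a" and D: "\<And>s. \<bar>smooth_step' s\<bar> \<le> D"
  shows "norm (gradient (extremal c a) x) powr p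
    \<le> c powr p * (\<bar>extremal c a x\<bar> powr p / norm x powr p)
      + (12 * D + 4) powr p * indicator (cball 0 (sqrt 2)) x
      + ((12 * D + 1) * a powr ((c - 1) / 2)) powr p * indicator (cball 0 (sqrt (2 * a))) x"
proof -
  define t where "t = x \<bullet> x"
  have nx: "norm x = sqrt t" by (simp add: t_def norm_eq_sqrt_inner)
  have t0: "0 \<le> t" by (simp add: t_def)
  have a0: "0 < a" using a by simp
  have D0: "0 \<le> D" using D[of 0] by linarith
  have g: "norm (gradient (extremal c a) x) = 2 * \<bar>profile' c a t\<bar> * sqrt t"
    by (simp add: gradient_extremal[OF a0] t_def[symmetric] nx abs_mult)
  consider "t \<le> 2" | "2 < t" "t \<le> a" | "a < t" "t \<le> 2 * a" | "2 * a < t"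
    by linarith
  then show ?thesis
  proof cases
    case 1
    \<comment> \<open>\<open>12 D + 4 = 2 * (3 D + 1) * 2\<close>, with the last factor an upper bound for \<open>|x|\<close>.\<close>
    have "sqrt t \<le> sqrt (2\<^sup>2)"
      using 1 by (intro real_sqrt_le_mono) simp
    then have "2 * \<bar>profile' c a t\<bar> * sqrt t \<le> 2 * (3 * D + 1) * 2"
      using profile'_lower_transition[OF c a t0 1 D] t0 by (intro mult_mono) auto
    then have "norm (gradient (extremal c a) x) powr p \<le> (12 * D + 4) powr p"
      using p t0 unfolding g by (intro powr_mono2) auto
    moreover have "x \<in> cball 0 (sqrt 2)"
      using 1 by (simp add: nx)
    ultimately show ?thesis
      by (simp add: add_increasing2 add_increasing)
  next
    case 2
    have "2 * \<bar>profile' c a t\<bar> * sqrt t = c * profile c a t * (sqrt t / (1 + t))"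
    proof -
      have "\<bar>profile' c a t\<bar> = c / 2 * profile c a t / (1 + t)"
        using 2 c a0 by (simp add: profile_plateau(2) profile_nonneg)
      then show ?thesis
        by (simp only:) (simp add: divide_inverse[of _ "1 + t"] mult_ac)
    qed
    also have "\<dots> \<le> c * profile c a t * (1 / sqrt t)"
    proof (intro mult_left_mono)
      show "sqrt t / (1 + t) \<le> 1 / sqrt t"
        using 2 by (simp add: divide_simps)
    qed (use c profile_nonneg in auto)
    also have "\<dots> = c * (\<bar>extremal c a x\<bar> / norm x)"
      by (simp add: extremal_def t_def[symmetric] nx profile_nonneg)
    finally have "norm (gradient (extremal c a) x) powr p \<le> (c * (\<bar>extremal c a x\<bar> / norm x)) powr p"
      using p t0 unfolding g by (intro powr_mono2) auto
    then have "norm (gradient (extremal c a) x) powr p \<le> c powr p * (\<bar>extremal c a x\<bar> powr p / norm x powr p)"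
      by (simp only: powr_mult powr_divide)
    then show ?thesis
      by (simp add: add_increasing2)
  next
    case 3
    have "norm (gradient (extremal c a) x) powr p \<le> ((12 * D + 1) * a powr ((c - 1) / 2)) powr p"
      using p t0 3 profile'_upper_transition[OF c a _ _ D, of t] unfolding g by (intro powr_mono2) auto
    moreover have "x \<in> cball 0 (sqrt (2 * a))"
      using 3 by (simp add: nx)
    ultimately show ?thesis
      by (simp add: add_increasing2 add_increasing)
  next
    case 4
    then have "gradient (extremal c a) x = 0"
      by (simp add: gradient_extremal[OF a0] extremal_zero[OF a0] t_def)
    then show ?thesis
      by (simp add: D0)
  qed
qed

lemma extremal_quotient_lower_bound:
  fixes x :: "real ^ 'n"
  assumes c: "0 < c" and p: "0 < p" and a: "2 \<le> a" and x: "2 \<le> x \<bullet> x" "x \<bullet> x \<le> a"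
  shows "(smooth_step 1)\<^sup>2 powr p * norm x powr (c * p - p) \<le> \<bar>extremal c a x\<bar> powr p / norm x powr p"
proof -
  have nx: "0 < norm x" using x by auto
  have "norm x powr c = (x \<bullet> x) powr (c / 2)"
    by (simp add: norm_eq_sqrt_inner powr_half_sqrt[symmetric] powr_powr)
  also have "\<dots> \<le> (1 + x \<bullet> x) powr (c / 2)"
    using c by (intro powr_mono2) auto
  finally have "(smooth_step 1)\<^sup>2 * norm x powr c \<le> \<bar>extremal c a x\<bar>"
    using x a profile_plateau(1)[of "x \<bullet> x" a c] by (simp add: extremal_def mult_left_mono)
  then have "((smooth_step 1)\<^sup>2 * norm x powr c) powr p \<le> \<bar>extremal c a x\<bar> powr p"
    using p by (intro powr_mono2) auto
  then have "((smooth_step 1)\<^sup>2 * norm x powr c) powr p / norm x powr p \<le> \<bar>extremal c a x\<bar> powr p / norm x powr p"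
    by (rule divide_right_mono) simp
  then show ?thesis
    by (simp add: powr_mult powr_powr powr_diff)
qed

section \<open>Optimality of the constant\<close>

context dunkl_setting
begin

text \<open>The homogeneous function of degree \<open>- hom_dim\<close>, cut down to one dyadic shell.  Its dilates tile the punctured
space, and all of them have the same integral after normalization.\<close>

definition shell :: "real ^ 'n \<Rightarrow> real" where
  "shell x = (if 1 \<le> norm x \<and> norm x < 2 then norm x powr (- hom_dim) else 0)"

text \<open>The same homogeneous function on \<open>m\<close> consecutive dyadic shells.  They start at radius 2, inside the region
where the lower cutoff of the test functions is already constant.\<close>

definition annulus :: "nat \<Rightarrow> real ^ 'n \<Rightarrow> real" where
  "annulus m x = (if 2 \<le> norm x \<and> norm x < 2 ^ Suc m then norm x powr (- hom_dim) else 0)"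

lemma integrable_inverse_power:
  fixes P :: "real ^ 'n \<Rightarrow> bool"
  assumes [measurable]: "Measurable.pred borel P"
    and P: "\<And>x. P x \<Longrightarrow> 1 \<le> norm x" "\<And>x. P x \<Longrightarrow> norm x \<le> r"
  shows "integrable \<mu> (\<lambda>x. if P x then norm x powr (- hom_dim) else 0)"
proof (rule integrable_bounded_support)
  show "\<bar>if P x then norm x powr (- hom_dim) else 0\<bar> \<le> 1" for x
    using P[of x] hom_dim_pos powr_mono2'[of "- hom_dim" 1 "norm x"] by auto
  show "(if P x then norm x powr (- hom_dim) else 0) = 0" if "r < norm x" for x
    using P[of x] that by auto
qed measurable

lemma integrable_shell: "integrable \<mu> shell"
  unfolding shell_def[abs_def] by (rule integrable_inverse_power[where r = 2]) auto

lemma integrable_annulus: "integrable \<mu> (annulus m)"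
  unfolding annulus_def[abs_def] by (rule integrable_inverse_power[where r = "2 ^ Suc m"]) auto

text \<open>The weight vanishes only on finitely many hyperplanes, which cannot cover a nonempty open set up to a null set.\<close>

lemma shell_integral_pos: "0 < (LINT x|\<mu>. shell x)"
proof (rule ccontr)
  assume "\<not> 0 < (LINT x|\<mu>. shell x)"
  have nonneg: "0 \<le> shell x" for x
    by (simp add: shell_def)
  then have "0 \<le> (LINT x|\<mu>. shell x)"
    by (rule Bochner_Integration.integral_nonneg)
  with \<open>\<not> 0 < _\<close> have "(LINT x|\<mu>. shell x) = 0" by simp
  then have "AE x in \<mu>. shell x = 0"
    using integral_nonneg_eq_0_iff_AE[OF integrable_shell] nonneg by simp
  then have "AE x in lborel. 0 < w x \<longrightarrow> shell x = 0"
    unfolding dunkl_measure_def by (subst (asm) AE_density) auto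
  then have "AE x in lebesgue. 0 < w x \<longrightarrow> shell x = 0"
    by (rule AE_completion)
  then obtain N where N: "N \<in> null_sets lebesgue" "{x. \<not> (0 < w x \<longrightarrow> shell x = 0)} \<subseteq> N"
    by (auto simp: eventually_ae_filter)
  let ?S = "{x :: real ^ 'n. 1 < norm x \<and> norm x < 2}"
  have "?S \<subseteq> N \<union> (\<Union>\<alpha>\<in>Rp. {x. \<alpha> \<bullet> x = 0})"
  proof
    fix x :: "real ^ 'n" assume x: "x \<in> ?S"
    have "0 < w x" if "\<And>\<alpha>. \<alpha> \<in> Rp \<Longrightarrow> \<alpha> \<bullet> x \<noteq> 0"
      unfolding dunkl_weight_def using that by (intro prod_pos) auto
    moreover have "shell x \<noteq> 0"
      using x by (auto simp: shell_def)
    ultimately show "x \<in> N \<union> (\<Union>\<alpha>\<in>Rp. {x. \<alpha> \<bullet> x = 0})"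
      using N(2) by blast
  qed
  moreover have "negligible (N \<union> (\<Union>\<alpha>\<in>Rp. {x. \<alpha> \<bullet> x = 0}))"
    using N(1) finite_Rp root_nonzero Rp_subset
    by (auto intro!: negligible_Un negligible_hyperplane simp: negligible_iff_null_sets[of N])
  ultimately have "negligible ?S"
    by (rule negligible_subset[rotated])
  moreover have "open ?S"
    by (intro open_Collect_conj open_Collect_less continuous_intros)
  moreover have "?S \<noteq> {}"
  proof -
    obtain x :: "real ^ 'n" where "norm x = 3 / 2"
      using vector_choose_size[of "3 / 2"] by auto
    then have "x \<in> ?S" by simp
    then show ?thesis by blast
  qed
  ultimately show False
    using open_not_negligible by blast
qed

lemma scaled_shell:
  assumes "0 < b"
  shows "shell ((1 / b) *\<^sub>R x) =
     b powr hom_dim * (if b \<le> norm x \<and> norm x < 2 * b then norm x powr (- hom_dim) else 0)"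
proof -
  have "norm ((1 / b) *\<^sub>R x) = norm x / b"
    using assms by simp
  moreover have "(norm x / b) powr (- hom_dim) = b powr hom_dim * norm x powr (- hom_dim)"
    by (simp add: powr_divide powr_minus_divide)
  moreover have "1 \<le> norm x / b \<longleftrightarrow> b \<le> norm x" "norm x / b < 2 \<longleftrightarrow> norm x < 2 * b"
    using assms by (simp_all add: le_divide_eq divide_less_eq)
  ultimately show ?thesis
    using assms by (simp add: shell_def)
qed

lemma annulus_Suc:
  "annulus (Suc m) x = annulus m x + (2 ^ Suc m) powr (- hom_dim) * shell ((1 / 2 ^ Suc m) *\<^sub>R x)"
proof -
  define b :: real where "b = 2 ^ Suc m"
  have b: "2 \<le> b" "0 < b" and b2: "2 ^ Suc (Suc m) = 2 * b"
    by (simp_all add: b_def)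
  have "b powr (- hom_dim) * (b powr hom_dim * y) = y" for y
    using b by (simp add: powr_minus)
  then show ?thesis
    unfolding annulus_def b2 b_def[symmetric] scaled_shell[OF b(2)] using b by auto
qed

lemma integral_annulus: "(LINT x|\<mu>. annulus m x) = real m * (LINT x|\<mu>. shell x)"
proof (induction m)
  case 0
  have "annulus 0 = (\<lambda>x. 0)" by (auto simp: annulus_def fun_eq_iff)
  then show ?case by simp
next
  case (Suc m)
  define s :: real where "s = 1 / 2 ^ Suc m"
  have [measurable]: "shell \<in> borel_measurable borel"
    using borel_measurable_integrable[OF integrable_shell] by simp
  have s: "0 < s" by (simp add: s_def)
  have "(LINT x|\<mu>. (2 ^ Suc m) powr (- hom_dim) * shell (s *\<^sub>R x))
      = (2 ^ Suc m) powr (- hom_dim) * (s powr (- hom_dim) * (LINT x|\<mu>. shell x))"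
    by (simp add: integral_scale[OF s])
  also have "\<dots> = (LINT x|\<mu>. shell x)"
    by (simp add: s_def powr_divide powr_minus)
  finally have shell: "(LINT x|\<mu>. (2 ^ Suc m) powr (- hom_dim) * shell (s *\<^sub>R x)) = (LINT x|\<mu>. shell x)" .
  have "integrable \<mu> (\<lambda>x. annulus (Suc m) x - annulus m x)"
    using integrable_annulus by (intro Bochner_Integration.integrable_diff)
  then have "integrable \<mu> (\<lambda>x. (2 ^ Suc m) powr (- hom_dim) * shell (s *\<^sub>R x))"
    by (simp only: annulus_Suc s_def add_diff_cancel_left')
  then have "(LINT x|\<mu>. annulus (Suc m) x) = (LINT x|\<mu>. annulus m x) + (LINT x|\<mu>. shell x)"
    using shell integrable_annulus unfolding annulus_Suc s_def[symmetric] by simp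
  then show ?case
    using Suc by (simp add: algebra_simps)
qed

lemma measure_cball_scale:
  assumes s: "0 < s"
  shows "measure \<mu> (cball 0 (s * r)) = s powr hom_dim * measure \<mu> (cball 0 r)"
proof -
  have scaled: "indicator (cball 0 r) x = (indicator (cball 0 (s * r)) (s *\<^sub>R x) :: real)" for x :: "real ^ 'n"
    using s by (simp add: indicator_def)
  have "measure \<mu> (cball 0 r) = (LINT x|\<mu>. indicator (cball 0 r) x)"
    by simp
  also have "\<dots> = (LINT x|\<mu>. indicator (cball 0 (s * r)) (s *\<^sub>R x))"
    by (simp only: scaled)
  also have "\<dots> = s powr (- hom_dim) * (LINT x|\<mu>. indicator (cball 0 (s * r)) x)"
    by (rule integral_scale[OF s]) (intro borel_measurable_indicator borel_closed closed_cball)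
  finally have "measure \<mu> (cball 0 r) = s powr (- hom_dim) * measure \<mu> (cball 0 (s * r))"
    by simp
  then show ?thesis
    using s by (simp add: powr_minus)
qed

lemma dunkl_gradient_radial:
  assumes "\<And>x y. norm x = norm y \<Longrightarrow> u x = u y"
  shows "dunkl_gradient Rp k u x = gradient u x"
proof -
  have "u (reflection \<alpha> x) = u x" if "\<alpha> \<in> Rp" for \<alpha>
    using that Rp_subset root_nonzero by (intro assms norm_reflection) auto
  then show ?thesis
    by (simp add: dunkl_gradient_def dunkl_operator_def gradient_def)
qed

text \<open>Testing the inequality on the functions \<open>extremal c a\<close> bounds \<open>(C - c powr p) J\<close> by a constant
\<open>E\<close>, where \<open>J\<close> is the integral of \<open>|u| powr p / |x| powr p\<close>; but \<open>J\<close> is at least a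
multiple of the number \<open>m\<close> of dyadic shells below \<open>sqrt a\<close>.\<close>

lemma hardy_constant_optimal:
  assumes p: "hom_dim < p" and C: "((p - hom_dim) / p) powr p < C"
  shows "\<exists>u\<in>test_functions_off_origin. \<not> dunkl_hardy_inequality Rp k p C u"
proof (rule ccontr)
  assume "\<not> ?thesis"
  then have hardy: "dunkl_hardy_inequality Rp k p C u" if "u \<in> test_functions_off_origin" for u
    using that by blast
  have p0: "0 < p" using p hom_dim_pos by linarith
  define c where "c = (p - hom_dim) / p"
  have c: "0 < c" "c < 1" "c * p - p = - hom_dim"
    using p hom_dim_pos p0 by (auto simp: c_def field_simps)
  obtain D where D: "\<And>s. \<bar>smooth_step' s\<bar> \<le> D"
    using smooth_step'_bounded by metis
  have D0: "0 \<le> D" using D[of 0] by linarith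
  define \<kappa> where "\<kappa> = (smooth_step 1)\<^sup>2 powr p"
  have \<kappa>: "0 < \<kappa>" using smooth_step_1_pos by (simp add: \<kappa>_def)
  define V where "V = (LINT x|\<mu>. shell x)"
  define I where "I = measure \<mu> (cball 0 (sqrt 2))"
  define E where "E = (12 * D + 4) powr p * I + (12 * D + 1) powr p * I"
  have bound: "(C - c powr p) * (\<kappa> * (real m * V)) \<le> E" for m
  proof -
    \<comment> \<open>The outer radius of the plateau is \<open>sqrt a\<close>, to match the annulus with \<open>m\<close> shells.\<close>
    define a :: real where "a = 4 ^ Suc m"
    have a: "2 \<le> a" "0 < a" "sqrt a = 2 ^ Suc m"
    proof -
      have "(1::real) \<le> 4 ^ m" "a = 4 * 4 ^ m" by (simp_all add: a_def)
      then show "2 \<le> a" by linarith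
      then show "0 < a" by simp
      have "a = (2 ^ Suc m)\<^sup>2"
        using power_mult_distrib[of "2::real" 2 "Suc m"] by (simp add: a_def power2_eq_square del: power_Suc)
      then show "sqrt a = 2 ^ Suc m"
        by (intro real_sqrt_unique) simp_all
    qed
    define u :: "real ^ 'n \<Rightarrow> real" where "u = extremal c a"
    have u: "u \<in> test_functions_off_origin"
      unfolding u_def using a by (intro extremal_test_function)
    interpret u: dunkl_test_function R Rp k u
      by unfold_locales (rule u)
    have radial: "dunkl_gradient Rp k u x = gradient u x" for x
    proof (rule dunkl_gradient_radial)
      show "norm x = norm y \<Longrightarrow> u x = u y" for x y
        by (simp add: u_def extremal_def dot_square_norm)
    qed
    define H where "H x = \<bar>u x\<bar> powr p / norm x powr p" for x
    have H_nonneg: "0 \<le> H x" for x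
      by (simp add: H_def)
    have int_H: "integrable \<mu> H"
      using u.integrable_quotient_powr[of p] p0 by (simp add: H_def[abs_def] powr_divide)
    define J where "J = (LINT x|\<mu>. H x)"
    have "C * J \<le> (LINT x|\<mu>. norm (gradient u x) powr p)"
      using hardy[OF u] by (simp add: dunkl_hardy_inequality_def radial J_def H_def)
    also have "\<dots> \<le> (LINT x|\<mu>. c powr p * H x
      + (12 * D + 4) powr p * indicator (cball 0 (sqrt 2)) x
      + ((12 * D + 1) * a powr ((c - 1) / 2)) powr p * indicator (cball 0 (sqrt (2 * a))) x)"
    proof (rule integral_mono')
      show "norm (gradient u x) powr p \<le> c powr p * H x
          + (12 * D + 4) powr p * indicator (cball 0 (sqrt 2)) x
          + ((12 * D + 1) * a powr ((c - 1) / 2)) powr p * indicator (cball 0 (sqrt (2 * a))) x" for x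
        unfolding H_def u_def by (rule extremal_gradient_bound[OF c(1,2) p0 a(1) D])
    qed (use int_H H_nonneg integrable_indicator_cball in \<open>auto intro!: add_nonneg_nonneg mult_nonneg_nonneg\<close>)
    also have "\<dots> = c powr p * J + (12 * D + 4) powr p * I
        + ((12 * D + 1) * a powr ((c - 1) / 2)) powr p * measure \<mu> (cball 0 (sqrt (2 * a)))"
      using int_H integrable_indicator_cball by (simp add: J_def I_def)
    also have "\<dots> = c powr p * J + E"
    proof -
      \<comment> \<open>The choice of \<open>c\<close> makes the powers of \<open>a\<close> cancel: the outer transition costs the same for every \<open>a\<close>.\<close>
      have "(c - 1) / 2 * p + hom_dim / 2 = (c * p - p + hom_dim) / 2"
        by (simp add: field_simps)
      then have "((12 * D + 1) * a powr ((c - 1) / 2)) powr p * a powr (hom_dim / 2)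
          = (12 * D + 1) powr p * a powr ((c * p - p + hom_dim) / 2)"
        by (simp only: powr_mult powr_powr mult.assoc powr_add[symmetric])
      also have "\<dots> = (12 * D + 1) powr p"
        using a by (simp add: c(3))
      finally have "((12 * D + 1) * a powr ((c - 1) / 2)) powr p * a powr (hom_dim / 2) = (12 * D + 1) powr p" .
      moreover have "measure \<mu> (cball 0 (sqrt (2 * a))) = a powr (hom_dim / 2) * I"
        using measure_cball_scale[of "sqrt a" "sqrt 2"] a(2)
        by (simp add: I_def real_sqrt_mult mult.commute powr_half_sqrt[symmetric] powr_powr)
      ultimately have "((12 * D + 1) * a powr ((c - 1) / 2)) powr p * measure \<mu> (cball 0 (sqrt (2 * a)))
          = (12 * D + 1) powr p * I"
        by (metis mult.assoc)
      then show ?thesis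
        by (simp add: E_def)
    qed
    finally have "(C - c powr p) * J \<le> E"
      by (simp add: algebra_simps)
    moreover have "\<kappa> * (real m * V) \<le> J"
    proof -
      have "\<kappa> * (real m * V) = (LINT x|\<mu>. \<kappa> * annulus m x)"
        by (simp add: V_def integral_annulus)
      also have "\<dots> \<le> J"
        unfolding J_def
      proof (rule integral_mono')
        fix x :: "real ^ 'n"
        show "\<kappa> * annulus m x \<le> H x"
        proof (cases "2 \<le> norm x \<and> norm x < 2 ^ Suc m")
          case True
          then have "2\<^sup>2 \<le> (norm x)\<^sup>2" "(norm x)\<^sup>2 \<le> (sqrt a)\<^sup>2"
            unfolding a(3) by (intro power_mono; simp)+
          then have "2 \<le> x \<bullet> x" "x \<bullet> x \<le> a"
            using a(2) by (auto simp: power2_norm_eq_inner)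
          then show ?thesis
            using True extremal_quotient_lower_bound[OF c(1) p0 a(1), of x]
            by (simp add: c(3) \<kappa>_def u_def annulus_def H_def)
        qed (auto simp: annulus_def H_nonneg)
      qed (use int_H H_nonneg in auto)
      finally show ?thesis .
    qed
    then have "(C - c powr p) * (\<kappa> * (real m * V)) \<le> (C - c powr p) * J"
      using C by (intro mult_left_mono) (auto simp: c_def)
    ultimately show ?thesis by linarith
  qed
  have "0 < (C - c powr p) * \<kappa> * V"
    using C \<kappa> shell_integral_pos by (simp add: c_def V_def)
  then obtain m :: nat where "E < real m * ((C - c powr p) * \<kappa> * V)"
    using reals_Archimedean3 by blast
  with bound[of m] show False
    by (simp add: mult_ac)
qed

end

theorem corollary3p10:
  fixes R Rp :: "(real ^ 'n) set" and k :: "real ^ 'n \<Rightarrow> real" and p :: real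
  assumes "normalized_root_system R"
    and "positive_subsystem R Rp"
    and "multiplicity_function R k"
    and "p > real CARD('n) + 2 * dunkl_gamma Rp k"
  shows "(\<forall>u\<in>test_functions_off_origin.
            dunkl_hardy_inequality Rp k p
              (((p - real CARD('n) - 2 * dunkl_gamma Rp k) / p) powr p) u) \<and>
         \<not> (\<exists>C > ((p - real CARD('n) - 2 * dunkl_gamma Rp k) / p) powr p.
               \<forall>u\<in>test_functions_off_origin. dunkl_hardy_inequality Rp k p C u)"
proof -
  interpret dunkl_setting R Rp k
    using assms by unfold_locales
  have p: "hom_dim < p" and const: "p - real CARD('n) - 2 * dunkl_gamma Rp k = p - hom_dim"
    using assms(4) unfolding hom_dim_def by linarith+
  have "1 \<le> real CARD('n)"
    using zero_less_card_finite[where 'a = 'n] by linarith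
  then have p1: "1 < p"
    using assms(4) gamma_nonneg by linarith
  have "dunkl_hardy_inequality Rp k p (((p - hom_dim) / p) powr p) u"
    if "u \<in> test_functions_off_origin" for u
  proof -
    interpret u: dunkl_test_function R Rp k u
      by unfold_locales (rule that)
    show ?thesis
      by (rule u.hardy_inequality[OF p1 p])
  qed
  moreover have "\<not> (\<exists>C > ((p - hom_dim) / p) powr p. \<forall>u\<in>test_functions_off_origin. dunkl_hardy_inequality Rp k p C u)"
  proof
    assume "\<exists>C > ((p - hom_dim) / p) powr p. \<forall>u\<in>test_functions_off_origin. dunkl_hardy_inequality Rp k p C u"
    then obtain C where "((p - hom_dim) / p) powr p < C"
      and "\<forall>u\<in>test_functions_off_origin. dunkl_hardy_inequality Rp k p C u"
      by metis
    with hardy_constant_optimal[OF p] show False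
      by metis
  qed
  ultimately show ?thesis
    unfolding const by (intro conjI ballI)
qed

end
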